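(* If $(\mathcal A,\mathcal A_0)$ is a uniquely negated metatangible pair, then Condition A1 holds: for every matrix over $\mathcal A$, the submatrix rank is less than or equal to the row rank and the column rank.
   Context: $\mathcal T$ is a commutative multiplicative monoid with unit $1$; $\mathcal A$ is a $\mathcal T$-bimodule: a commutative additive semigroup $(\mathcal A,+,0)$ with zero and compatible left and right actions of $\mathcal T$ satisfying $a0=0$, $a(b_1+b_2)=ab_1+ab_2$, $1b=b$ (and right-hand versions), $(a_1b)a_2=a_1(ba_2)$, $(a_1a_2)b=a_1(a_2b)$. $\mathcal T_0=\mathcal T\cup\{0\}\subseteq\mathcal A$ ($0\notin\mathcal T$, $a1=1a=a$). Admissible: $\mathcal T_0$ spans $(\mathcal A,+)$. $\mathcal A_0$ is a sub-bimodule with $\mathcal A_0\cap\mathcal T_0=\{0\}$. Multiplication on $\mathcal A$: $(\sum a_i)(\sum a_j')=\sum a_ia_j'$ for $a_i,a_j'\in\mathcal T$. Standing assumptions: for $a\in\mathcal T$, $ab\in\mathcal A_0$ or $ba\in\mathcal A_0$ implies $b\in\mathcal A_0$; $ab_1=ab_2$ or $b_1a=b_2a$ implies $b_1=b_2$; $(k1)(k'1)=(kk')1$ for $k,k'\in\mathbb N^+$. A negation map is an automorphism $(-)$ of $(\mathcal A,+,0)$ of order $\le2$ leaving $\mathcal T$ invariant, with $1+((-)1)\in\mathcal A_0$, and $((-)a)b=(-)(ab)=a((-)b)$, $((-)b)a=(-)(ba)=b((-)a)$ for $a\in\mathcal T$. Uniquely negated: there is a negation map, and $a+a'\in\mathcal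 A_0$ with $a,a'\in\mathcal T$ implies $a'=(-)a$. Put $a^\circ=a+((-)a)$. The pair is metatangible if it is admissible, $a_1+a_2\in\mathcal T\cup\mathcal A_0$ for all $a_1,a_2\in\mathcal T$, and Property N holds (which follows here from unique negation: $a_1+a_2=a_1^\circ$ whenever $a_1,a_2\in\mathcal T$ and $a_1+a_2\in\mathcal A_0$). Vectors $\mathbf v_i\in\mathcal A^{(n)}$ ($i\in I$) are dependent if $\sum_{i\in I'}a_i\mathbf v_i\in\mathcal A_0^{(n)}$ for some nonempty finite $I'\subseteq I$ and $a_i\in\mathcal T$; otherwise independent. Row (column) rank of a matrix: the maximal number of independent rows (columns). The determinant is $|A|=\sum_{\pi\in S_n}(-)^\pi a_{\pi(1),1}\cdots a_{\pi(n),n}$, with $(-)^\pi$ the identity for even $\pi$ and $(-)$ for odd $\pi$; $A$ is singular if $|A|\in\mathcal A_0$ (equivalently, the even and odd parts of the determinant are balanced with respect to $b_1\nabla b_2\Leftrightarrow b_1+((-)b_2)\in\mathcal A_0$). Submatrix rank: the largest size of a nonsingular square submatrix. *)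

theory Defs
  imports "Jordan_Normal_Form.DL_Submatrix"
begin

text \<open>
  The monoid \<open>\<T>\<close> is a type \<open>'t\<close> and the semigroup \<open>(\<A>, +, 0)\<close> is a type \<open>'a\<close>. The inclusion
  \<open>\<T> \<subseteq> \<A>\<close> is an injection \<open>emb\<close>, so that \<open>range emb\<close> is \<open>\<T>\<close> viewed inside \<open>\<A>\<close>.
\<close>

locale bimodule =
  fixes lact :: "'t::comm_monoid_mult \<Rightarrow> 'a::comm_monoid_add \<Rightarrow> 'a"  (infixr \<open>\<rhd>\<close> 75)
    and ract :: "'a \<Rightarrow> 't \<Rightarrow> 'a"  (infixl \<open>\<lhd>\<close> 75)
  assumes lact_zero: "a \<rhd> 0 = 0"
    and ract_zero: "0 \<lhd> a = 0"
    and lact_add: "a \<rhd> (b1 + b2) = a \<rhd> b1 + a \<rhd> b2"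
    and ract_add: "(b1 + b2) \<lhd> a = b1 \<lhd> a + b2 \<lhd> a"
    and lact_one: "1 \<rhd> b = b"
    and ract_one: "b \<lhd> 1 = b"
    and lact_ract: "(a1 \<rhd> b) \<lhd> a2 = a1 \<rhd> (b \<lhd> a2)"
    and lact_mult: "(a1 * a2) \<rhd> b = a1 \<rhd> (a2 \<rhd> b)"
    and ract_mult: "b \<lhd> (a1 * a2) = (b \<lhd> a1) \<lhd> a2"

locale bimodule_pair = bimodule lact ract
  for lact :: "'t::comm_monoid_mult \<Rightarrow> 'a::comm_monoid_add \<Rightarrow> 'a"  (infixr \<open>\<rhd>\<close> 75)
    and ract :: "'a \<Rightarrow> 't \<Rightarrow> 'a"  (infixl \<open>\<lhd>\<close> 75) +
  fixes emb :: "'t \<Rightarrow> 'a"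
    and A0 :: "'a set"
  assumes inj_emb: "inj emb"
    and zero_notin_T: "0 \<notin> range emb"
    and lact_emb_one: "a \<rhd> emb 1 = emb a"
    and ract_emb_one: "emb 1 \<lhd> a = emb a"
    and A0_zero: "0 \<in> A0"
    and A0_add: "b1 \<in> A0 \<Longrightarrow> b2 \<in> A0 \<Longrightarrow> b1 + b2 \<in> A0"
    and A0_lact: "b \<in> A0 \<Longrightarrow> a \<rhd> b \<in> A0"
    and A0_ract: "b \<in> A0 \<Longrightarrow> b \<lhd> a \<in> A0"
    and A0_Int_T0: "A0 \<inter> insert 0 (range emb) = {0}"

locale admissible_pair = bimodule_pair +
  assumes T0_spans: "\<exists>bs. set bs \<subseteq> insert 0 (range emb) \<and> b = sum_list bs"

text \<open>
  The product on \<open>\<A>\<close> extends that of \<open>\<T>\<close> biadditively. It does not depend on the chosen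
  representations as sums of elements of \<open>\<T>\<close>; see \<open>pair_mult_sums\<close> below.
\<close>

definition pair_mult :: "('t::comm_monoid_mult \<Rightarrow> 'a::comm_monoid_add) \<Rightarrow> 'a \<Rightarrow> 'a \<Rightarrow> 'a"
  where "pair_mult emb b b' = (THE c. \<exists>as as'.
    b = (\<Sum>a\<leftarrow>as. emb a) \<and> b' = (\<Sum>a'\<leftarrow>as'. emb a') \<and>
    c = (\<Sum>a\<leftarrow>as. \<Sum>a'\<leftarrow>as'. emb (a * a')))"

context bimodule_pair
begin

lemma lact_emb: "a \<rhd> emb a' = emb (a * a')"
  by (metis lact_emb_one lact_mult)

lemma ract_emb: "emb a \<lhd> a' = emb (a * a')"
  by (metis ract_emb_one ract_mult)

lemma lact_sum_list: "a \<rhd> (\<Sum>x\<leftarrow>xs. f x) = (\<Sum>x\<leftarrow>xs. a \<rhd> f x)"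
  by (induction xs) (simp_all add: lact_zero lact_add)

lemma ract_sum_list: "(\<Sum>x\<leftarrow>xs. f x) \<lhd> a = (\<Sum>x\<leftarrow>xs. f x \<lhd> a)"
  by (induction xs) (simp_all add: ract_zero ract_add)

lemma sum_list_swap:
  "(\<Sum>x\<leftarrow>xs. \<Sum>y\<leftarrow>ys. g x y) = (\<Sum>y\<leftarrow>ys. \<Sum>x\<leftarrow>xs. g x y :: 'a)"
  by (induction xs) (simp_all add: sum_list_addf)

lemma pair_mult_sums:
  "pair_mult emb (\<Sum>a\<leftarrow>as. emb a) (\<Sum>a'\<leftarrow>as'. emb a') = (\<Sum>a\<leftarrow>as. \<Sum>a'\<leftarrow>as'. emb (a * a'))"
proof -
  have l: "(\<Sum>a\<leftarrow>xs. \<Sum>a'\<leftarrow>ys. emb (a * a')) = (\<Sum>a\<leftarrow>xs. a \<rhd> (\<Sum>a'\<leftarrow>ys. emb a'))" for xs ys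
    by (simp add: lact_sum_list lact_emb)
  have r: "(\<Sum>a\<leftarrow>xs. \<Sum>a'\<leftarrow>ys. emb (a * a')) = (\<Sum>a'\<leftarrow>ys. (\<Sum>a\<leftarrow>xs. emb a) \<lhd> a')" for xs ys
  proof -
    have "(\<lhd>) (\<Sum>a\<leftarrow>xs. emb a) = (\<lambda>a'. \<Sum>a\<leftarrow>xs. emb (a * a'))"
      by (rule ext) (simp add: ract_sum_list ract_emb)
    then show ?thesis by (simp add: sum_list_swap[of _ ys])
  qed
  show ?thesis
    unfolding pair_mult_def
  proof (rule the_equality, blast)
    fix c
    assume "\<exists>bs bs'. (\<Sum>a\<leftarrow>as. emb a) = (\<Sum>a\<leftarrow>bs. emb a) \<and>
      (\<Sum>a'\<leftarrow>as'. emb a') = (\<Sum>a'\<leftarrow>bs'. emb a') \<and> c = (\<Sum>a\<leftarrow>bs. \<Sum>a'\<leftarrow>bs'. emb (a * a'))"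
    then obtain bs bs' where "(\<Sum>a\<leftarrow>as. emb a) = (\<Sum>a\<leftarrow>bs. emb a)"
      "(\<Sum>a'\<leftarrow>as'. emb a') = (\<Sum>a'\<leftarrow>bs'. emb a')" "c = (\<Sum>a\<leftarrow>bs. \<Sum>a'\<leftarrow>bs'. emb (a * a'))"
      by blast
    then show "c = (\<Sum>a\<leftarrow>as. \<Sum>a'\<leftarrow>as'. emb (a * a'))"
      by (metis l r)
  qed
qed

end

context admissible_pair
begin

lemma T_spans: obtains as where "b = (\<Sum>a\<leftarrow>as. emb a)"
proof -
  have "\<exists>as. sum_list bs = (\<Sum>a\<leftarrow>as. emb a)" if "set bs \<subseteq> insert 0 (range emb)" for bs
    using that
  proof (induction bs)
    case Nil
    then show ?case by (intro exI[of _ "[]"]) simp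
  next
    case (Cons b bs)
    then obtain as where as: "sum_list bs = (\<Sum>a\<leftarrow>as. emb a)" by auto
    from Cons.prems consider "b = 0" | a where "b = emb a" by auto
    then show ?case
    proof cases
      case 1
      with as show ?thesis by auto
    next
      case 2
      with as show ?thesis by (intro exI[of _ "a # as"]) simp
    qed
  qed
  moreover obtain bs where "set bs \<subseteq> insert 0 (range emb)" "b = sum_list bs"
    using T0_spans by blast
  ultimately show thesis using that by blast
qed

lemma pair_mult_emb_left: "pair_mult emb (emb a) b = a \<rhd> b"
proof -
  obtain as where "b = (\<Sum>a\<leftarrow>as. emb a)" by (rule T_spans)
  then show ?thesis
    using pair_mult_sums[of "[a]" as] by (simp add: lact_sum_list lact_emb)
qed

lemma pair_mult_emb_right: "pair_mult emb b (emb a) = b \<lhd> a"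
proof -
  obtain as where "b = (\<Sum>a\<leftarrow>as. emb a)" by (rule T_spans)
  then show ?thesis
    using pair_mult_sums[of as "[a]"] by (simp add: ract_sum_list ract_emb)
qed

end

text \<open>The element \<open>k1\<close> is the sum of \<open>k\<close> copies of \<open>1\<close>.\<close>

definition nat_multiple :: "('t::comm_monoid_mult \<Rightarrow> 'a::comm_monoid_add) \<Rightarrow> nat \<Rightarrow> 'a"
  where "nat_multiple emb k = sum_list (replicate k (emb 1))"

locale standard_pair = admissible_pair +
  assumes lact_in_A0: "a \<rhd> b \<in> A0 \<Longrightarrow> b \<in> A0"
    and ract_in_A0: "b \<lhd> a \<in> A0 \<Longrightarrow> b \<in> A0"
    and lact_cancel: "a \<rhd> b1 = a \<rhd> b2 \<Longrightarrow> b1 = b2"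
    and ract_cancel: "b1 \<lhd> a = b2 \<lhd> a \<Longrightarrow> b1 = b2"
    and nat_multiple_mult: "k > 0 \<Longrightarrow> k' > 0 \<Longrightarrow>
      pair_mult emb (nat_multiple emb k) (nat_multiple emb k') = nat_multiple emb (k * k')"

locale negated_pair = standard_pair lact ract emb A0
  for lact :: "'t::comm_monoid_mult \<Rightarrow> 'a::comm_monoid_add \<Rightarrow> 'a"  (infixr \<open>\<rhd>\<close> 75)
    and ract :: "'a \<Rightarrow> 't \<Rightarrow> 'a"  (infixl \<open>\<lhd>\<close> 75)
    and emb :: "'t \<Rightarrow> 'a"
    and A0 :: "'a set" +
  fixes neg :: "'a \<Rightarrow> 'a"
  assumes bij_neg: "bij neg"
    and neg_zero: "neg 0 = 0"
    and neg_add: "neg (b1 + b2) = neg b1 + neg b2"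
    and neg_neg: "neg (neg b) = b"
    and neg_T: "neg ` range emb = range emb"
    and one_quasi_zero: "emb 1 + neg (emb 1) \<in> A0"
    and neg_lact: "emb a' = neg (emb a) \<Longrightarrow> a' \<rhd> b = neg (a \<rhd> b)"
    and lact_neg: "a \<rhd> neg b = neg (a \<rhd> b)"
    and ract_neg: "emb a' = neg (emb a) \<Longrightarrow> b \<lhd> a' = neg (b \<lhd> a)"
    and neg_ract: "neg b \<lhd> a = neg (b \<lhd> a)"

locale uniquely_negated_pair = negated_pair +
  assumes unique_neg: "emb a + emb a' \<in> A0 \<Longrightarrow> emb a' = neg (emb a)"

locale uniquely_negated_metatangible_pair = uniquely_negated_pair +
  assumes sum_T: "emb a1 + emb a2 \<in> range emb \<union> A0"
    and property_N: "emb a1 + emb a2 \<in> A0 \<Longrightarrow> emb a1 + emb a2 = emb a1 + neg (emb a1)"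

definition dependent_family ::
  "('t \<Rightarrow> 'a::comm_monoid_add \<Rightarrow> 'a) \<Rightarrow> 'a set \<Rightarrow> nat \<Rightarrow> ('i \<Rightarrow> 'a vec) \<Rightarrow> 'i set \<Rightarrow> bool"
  where "dependent_family lact A0 n v I \<longleftrightarrow>
    (\<exists>I' a. I' \<subseteq> I \<and> finite I' \<and> I' \<noteq> {} \<and> (\<forall>j<n. (\<Sum>i\<in>I'. lact (a i) (v i $ j)) \<in> A0))"

text \<open>
  The empty family is independent, and rows are counted by index, so equal rows at different
  positions form a family of two vectors.
\<close>

definition row_rank ::
  "('t \<Rightarrow> 'a::comm_monoid_add \<Rightarrow> 'a) \<Rightarrow> 'a set \<Rightarrow> 'a mat \<Rightarrow> nat"
  where "row_rank lact A0 M = Max {card I | I.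
    I \<subseteq> {0..<dim_row M} \<and> \<not> dependent_family lact A0 (dim_col M) (row M) I}"

definition col_rank ::
  "('t \<Rightarrow> 'a::comm_monoid_add \<Rightarrow> 'a) \<Rightarrow> 'a set \<Rightarrow> 'a mat \<Rightarrow> nat"
  where "col_rank lact A0 M = Max {card J | J.
    J \<subseteq> {0..<dim_col M} \<and> \<not> dependent_family lact A0 (dim_row M) (col M) J}"

text \<open>For a square matrix; the determinant of the \<open>0 \<times> 0\<close> matrix is \<open>1\<close>.\<close>

definition pair_det ::
  "('t::comm_monoid_mult \<Rightarrow> 'a::comm_monoid_add) \<Rightarrow> ('a \<Rightarrow> 'a) \<Rightarrow> 'a mat \<Rightarrow> 'a"
  where "pair_det emb neg M = (\<Sum>\<pi> | \<pi> permutes {0..<dim_row M}.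
    (if evenperm \<pi> then id else neg)
      (foldr (pair_mult emb) (map (\<lambda>j. M $$ (\<pi> j, j)) [0..<dim_row M]) (emb 1)))"

definition nonsingular ::
  "('t::comm_monoid_mult \<Rightarrow> 'a::comm_monoid_add) \<Rightarrow> 'a set \<Rightarrow> ('a \<Rightarrow> 'a) \<Rightarrow> 'a mat \<Rightarrow> bool"
  where "nonsingular emb A0 neg M \<longleftrightarrow> pair_det emb neg M \<notin> A0"

text \<open>
  The empty submatrix is nonsingular because \<open>1 \<notin> \<A>\<^sub>0\<close>, so the maximum is over a nonempty set.
\<close>

definition submatrix_rank ::
  "('t::comm_monoid_mult \<Rightarrow> 'a::comm_monoid_add) \<Rightarrow> 'a set \<Rightarrow> ('a \<Rightarrow> 'a) \<Rightarrow> 'a mat \<Rightarrow> nat"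
  where "submatrix_rank emb A0 neg M = Max {card I | I J.
    I \<subseteq> {0..<dim_row M} \<and> J \<subseteq> {0..<dim_col M} \<and> card I = card J \<and>
    nonsingular emb A0 neg (submatrix M I J)}"

end

theory Submission
  imports Defs
begin

text \<open>
  What has to be shown is that a square matrix with dependent columns, or dependent rows, is
  singular; the rank inequalities follow by restricting a dependence among the rows or columns of
  \<open>M\<close> to a submatrix. The two versions are exchanged by transposition. So let \<open>x\<close> be a nonzero
  vector over \<open>\<T>\<^sub>0\<close> with \<open>A x\<close> in \<open>\<A>\<^sub>0\<^sup>n\<close>, and suppose that \<open>|A|\<close> is not in \<open>\<A>\<^sub>0\<close>.

  Expand \<open>|A| = \<Sum>\<^sub>k a\<^sub>k M\<^sub>k\<close> along one row, where \<open>M\<^sub>k\<close> is the determinant of the matrix obtained from \<open>A\<close>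
  by putting the \<open>k\<close>th unit vector in place of that row. Over a field, \<open>x\<close> would be proportional to
  the vector of the \<open>M\<^sub>k\<close>, and \<open>\<Sum>\<^sub>k a\<^sub>k x\<^sub>k\<close> proportional to \<open>|A|\<close>. In a pair the proportionality
  survives as \<open>x\<^sub>k M\<^sub>j + (-)x\<^sub>j M\<^sub>k \<in> \<A>\<^sub>0\<close>: the left side is the determinant of a matrix in which the
  columns \<open>j\<close> and \<open>k\<close> have been combined into one, and this matrix has a dependence among its columns
  inherited from \<open>x\<close>, while one more of its rows is a unit vector. Hence an induction on the number
  of rows that are not unit vectors applies (\<open>leibniz_singular_of_dependent_columns_unit_rows\<close>).
  What remains is to pass from \<open>x\<^sub>k M\<^sub>j + (-)x\<^sub>j M\<^sub>k \<in> \<A>\<^sub>0\<close> and \<open>\<Sum>\<^sub>k a\<^sub>k x\<^sub>k \<in> \<A>\<^sub>0\<close> to a contradiction with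
  \<open>\<Sum>\<^sub>k a\<^sub>k M\<^sub>k \<notin> \<A>\<^sub>0\<close>, for a well-chosen index \<open>j\<close>. This is \<open>exchange\<close>, the only place where
  metatangibility is used.

  Unique negation gives \<open>a\<degree> + b \<in> {b, a\<degree>}\<close> for tangible \<open>a\<close>, \<open>b\<close>, except perhaps if \<open>b = a = (-)a\<close>.
  This leads to two cases. If there is no exception, \<open>\<A> = \<T> \<union> \<A>\<^sub>0\<close>, and a tangible element can be
  replaced in a sum lying in \<open>\<A>\<^sub>0\<close> by any element balanced with it; so the usual elimination works
  with any \<open>j\<close> such that \<open>M\<^sub>j \<notin> \<A>\<^sub>0\<close>. If there is an exception, \<open>(-)\<close> is the identity, \<open>\<T>\<close> is totally ordered
  with the maximum as addition of distinct elements, and every element of \<open>\<A>\<close> is a multiple \<open>k a\<close> of a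
  tangible element. Then only the terms of maximal tangible part matter, and the contradiction comes
  from the parity of their multiplicities.
\<close>

section \<open>The commutative semiring structure\<close>

context admissible_pair
begin

abbreviation mult :: "'b \<Rightarrow> 'b \<Rightarrow> 'b"  (infixl \<open>\<cdot>\<close> 70)
  where "b \<cdot> b' \<equiv> pair_mult emb b b'"

lemma mult_add_left: "(b + b') \<cdot> c = b \<cdot> c + b' \<cdot> c"
proof -
  obtain as bs cs where "b = (\<Sum>a\<leftarrow>as. emb a)" "b' = (\<Sum>a\<leftarrow>bs. emb a)" "c = (\<Sum>a\<leftarrow>cs. emb a)"
    using T_spans by metis
  then show ?thesis
    using pair_mult_sums[of "as @ bs" cs] by (simp add: pair_mult_sums)
qed

lemma mult_commute: "b \<cdot> c = c \<cdot> b"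
proof -
  obtain bs cs where "b = (\<Sum>a\<leftarrow>bs. emb a)" "c = (\<Sum>a\<leftarrow>cs. emb a)"
    using T_spans by metis
  then show ?thesis
    by (simp add: pair_mult_sums sum_list_swap[of _ cs] mult.commute)
qed

lemma mult_add_right: "c \<cdot> (b + b') = c \<cdot> b + c \<cdot> b'"
  by (metis mult_commute mult_add_left)

lemma mult_one_left: "emb 1 \<cdot> b = b"
  by (simp add: pair_mult_emb_left lact_one)

lemma mult_one_right: "b \<cdot> emb 1 = b"
  by (simp add: pair_mult_emb_right ract_one)

lemma mult_zero_left: "0 \<cdot> b = 0"
proof -
  obtain bs where "b = (\<Sum>a\<leftarrow>bs. emb a)" by (rule T_spans)
  then show ?thesis using pair_mult_sums[of "[]" bs] by simp
qed

lemma mult_zero_right: "b \<cdot> 0 = 0"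
  by (metis mult_commute mult_zero_left)

lemma emb_mult_emb: "emb a \<cdot> emb a' = emb (a * a')"
  by (simp add: pair_mult_emb_left lact_emb)

text \<open>By additivity the claim reduces to a left factor in \<open>\<T>\<close>.\<close>

lemma mult_assoc: "(b \<cdot> c) \<cdot> d = b \<cdot> (c \<cdot> d)"
proof -
  obtain bs cs ds where b: "b = (\<Sum>a\<leftarrow>bs. emb a)" and c: "c = (\<Sum>a\<leftarrow>cs. emb a)"
    and d: "d = (\<Sum>a\<leftarrow>ds. emb a)"
    using T_spans by metis
  have tangible: "(emb a \<cdot> c) \<cdot> d = emb a \<cdot> (c \<cdot> d)" for a
  proof -
    have "emb a \<cdot> c = (\<Sum>x\<leftarrow>map ((*) a) cs. emb x)"
      by (simp add: c pair_mult_emb_left lact_sum_list lact_emb o_def)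
    then have "(emb a \<cdot> c) \<cdot> d = (\<Sum>x\<leftarrow>map ((*) a) cs. \<Sum>y\<leftarrow>ds. emb (x * y))"
      using pair_mult_sums[of "map ((*) a) cs" ds] d by simp
    also have "\<dots> = (\<Sum>x\<leftarrow>cs. \<Sum>y\<leftarrow>ds. a \<rhd> emb (x * y))"
      by (simp add: lact_emb o_def mult.assoc)
    also have "\<dots> = emb a \<cdot> (c \<cdot> d)"
      by (simp add: c d pair_mult_sums pair_mult_emb_left lact_sum_list)
    finally show ?thesis .
  qed
  have "((\<Sum>a\<leftarrow>bs. emb a) \<cdot> c) \<cdot> d = (\<Sum>a\<leftarrow>bs. emb a) \<cdot> (c \<cdot> d)"
    by (induction bs) (simp_all add: mult_zero_left mult_add_left tangible)
  then show ?thesis by (simp add: b)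
qed

sublocale pair_mult: comm_monoid_set "pair_mult emb" "emb 1"
  defines product = pair_mult.F
  by unfold_locales (rule mult_assoc mult_commute mult_one_right)+

lemma mult_sum_right: "c \<cdot> (\<Sum>k\<in>K. f k) = (\<Sum>k\<in>K. c \<cdot> f k)"
  by (induction K rule: infinite_finite_induct) (simp_all add: mult_zero_right mult_add_right)

lemma product_zero: "finite S \<Longrightarrow> s \<in> S \<Longrightarrow> f s = 0 \<Longrightarrow> product f S = 0"
  by (simp add: pair_mult.remove[of S s] mult_zero_left)

lemma foldr_mult_upt: "foldr (pair_mult emb) (map f [0..<n]) (emb 1) = product f {0..<n}"
proof -
  have "foldr (pair_mult emb) (map f xs) (emb 1) = product f (set xs)" if "distinct xs" for xs
    using that by (induction xs) simp_all
  from this[of "[0..<n]"] show ?thesis by simp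
qed

lemma A0_sum: "(\<And>k. k \<in> K \<Longrightarrow> f k \<in> A0) \<Longrightarrow> (\<Sum>k\<in>K. f k) \<in> A0"
  by (induction K rule: infinite_finite_induct) (simp_all add: A0_zero A0_add)

lemma A0_mult_right: "b \<in> A0 \<Longrightarrow> c \<cdot> b \<in> A0"
proof -
  assume b: "b \<in> A0"
  obtain cs where "c = (\<Sum>a\<leftarrow>cs. emb a)" by (rule T_spans)
  moreover have "(\<Sum>a\<leftarrow>cs. emb a) \<cdot> b \<in> A0"
    by (induction cs)
      (simp_all add: mult_zero_left mult_add_left A0_zero A0_add pair_mult_emb_left A0_lact b)
  ultimately show ?thesis by simp
qed

lemma A0_mult_left: "b \<in> A0 \<Longrightarrow> b \<cdot> c \<in> A0"
  by (metis A0_mult_right mult_commute)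

lemma emb_eq_iff: "emb a = emb b \<longleftrightarrow> a = b"
  using inj_emb by (rule inj_eq)

lemma emb_neq_zero: "emb a \<noteq> 0"
  using zero_notin_T by (metis rangeI)

lemma emb_notin_A0: "emb a \<notin> A0"
  using A0_Int_T0 zero_notin_T by (metis IntI insertI2 rangeI singletonD)

end

context negated_pair
begin

lemma emb_mult_in_A0: "emb a \<cdot> b \<in> A0 \<Longrightarrow> b \<in> A0"
  by (metis pair_mult_emb_left lact_in_A0)

lemma emb_mult_cancel: "emb a \<cdot> b = emb a \<cdot> c \<Longrightarrow> b = c"
  by (metis pair_mult_emb_left lact_cancel)

lemma neg_emb: obtains a' where "neg (emb a) = emb a'"
  using neg_T by blast

lemma neg_eq_mult: "neg b = neg (emb 1) \<cdot> b"
proof -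
  obtain u where u: "neg (emb 1) = emb u" by (rule neg_emb)
  then have "neg b = u \<rhd> b" using neg_lact[of u 1 b] by (simp add: lact_one)
  then show ?thesis by (simp add: u pair_mult_emb_left)
qed

lemma neg_mult_left: "neg b \<cdot> c = neg (b \<cdot> c)"
  by (metis neg_eq_mult mult_assoc)

lemma neg_mult_right: "b \<cdot> neg c = neg (b \<cdot> c)"
  by (metis neg_mult_left mult_commute)

lemma neg_sum: "neg (\<Sum>k\<in>K. f k) = (\<Sum>k\<in>K. neg (f k))"
  by (induction K rule: infinite_finite_induct) (simp_all add: neg_zero neg_add)

lemma A0_neg: "b \<in> A0 \<Longrightarrow> neg b \<in> A0"
  by (metis neg_eq_mult A0_mult_right)

lemma A0_neg_iff: "neg b \<in> A0 \<longleftrightarrow> b \<in> A0"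
  using A0_neg neg_neg by metis

lemma quasi_zero: "b + neg b \<in> A0"
proof -
  have "b + neg b = (emb 1 + neg (emb 1)) \<cdot> b"
    by (metis mult_add_left mult_one_left neg_eq_mult)
  then show ?thesis by (simp add: one_quasi_zero A0_mult_left)
qed

section \<open>Determinants\<close>

definition leibniz :: "'i set \<Rightarrow> ('i \<Rightarrow> 'i \<Rightarrow> 'a) \<Rightarrow> 'a"
  where "leibniz S A = (\<Sum>\<pi> | \<pi> permutes S.
    (if evenperm \<pi> then id else neg) (product (\<lambda>j. A (\<pi> j) j) S))"

lemma pair_det_eq_leibniz:
  "pair_det emb neg M = leibniz {0..<dim_row M} (\<lambda>i j. M $$ (i, j))"
  by (simp add: pair_det_def leibniz_def foldr_mult_upt)

lemma leibniz_cong: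
  assumes "\<And>i j. i \<in> S \<Longrightarrow> j \<in> S \<Longrightarrow> A i j = B i j"
  shows "leibniz S A = leibniz S B"
  unfolding leibniz_def
  by (intro sum.cong refl arg_cong[where f = "(if _ then id else neg)"] pair_mult.cong)
    (auto simp: assms permutes_in_image)

lemma leibniz_transpose:
  assumes S: "finite S"
  shows "leibniz S (\<lambda>i j. A j i) = leibniz S A"
proof -
  have "leibniz S A = (\<Sum>\<pi> | \<pi> permutes S.
      (if evenperm (inv_into UNIV \<pi>) then id else neg) (product (\<lambda>j. A (inv_into UNIV \<pi> j) j) S))"
    unfolding leibniz_def by (rule sum_permutations_inverse)
  also have "\<dots> = leibniz S (\<lambda>i j. A j i)"
    unfolding leibniz_def
  proof (intro sum.cong refl)
    fix \<pi>
    assume "\<pi> \<in> {\<pi>. \<pi> permutes S}"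
    then have p: "\<pi> permutes S" by simp
    have "product (\<lambda>j. A (inv_into UNIV \<pi> j) j) S = product (\<lambda>j. A (inv_into UNIV \<pi> (\<pi> j)) (\<pi> j)) S"
      using pair_mult.reindex_bij_betw[OF permutes_imp_bij[OF p], of "\<lambda>j. A (inv_into UNIV \<pi> j) j"] by simp
    also have "\<dots> = product (\<lambda>j. A j (\<pi> j)) S"
      by (simp add: permutes_inverses(2)[OF p])
    finally show "(if evenperm (inv_into UNIV \<pi>) then id else neg) (product (\<lambda>j. A (inv_into UNIV \<pi> j) j) S)
        = (if evenperm \<pi> then id else neg) (product (\<lambda>j. A j (\<pi> j)) S)"
      using evenperm_inv[OF permutation_permutes[THEN iffD2]] p S by auto
  qed
  finally show ?thesis by simp
qed

definition unit_row :: "'i \<Rightarrow> 'i \<Rightarrow> 'a"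
  where "unit_row k j = (if j = k then emb 1 else 0)"

lemma unit_row_simps [simp]: "unit_row k k = emb 1" "j \<noteq> k \<Longrightarrow> unit_row k j = 0"
  by (simp_all add: unit_row_def)

lemma product_unit_row_zero:
  assumes "finite S" "\<pi> permutes S" "i \<in> S" "\<pi> k \<noteq> i"
  shows "product (\<lambda>j. (A(i := unit_row k)) (\<pi> j) j) S = 0"
proof (rule product_zero)
  show "inv_into UNIV \<pi> i \<in> S" using assms by (metis permutes_inv permutes_in_image)
  show "(A(i := unit_row k)) (\<pi> (inv_into UNIV \<pi> i)) (inv_into UNIV \<pi> i) = 0"
    using assms by (auto simp: permutes_inverses(1) unit_row_def)
qed fact

text \<open>
  The cofactors are determinants over the same index set, with a unit row in place of row \<open>i\<close>. This
  avoids minors of smaller size: further rows can be expanded without renumbering anything.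
\<close>

lemma leibniz_expand_row:
  assumes S: "finite S" and i: "i \<in> S"
  shows "leibniz S A = (\<Sum>k\<in>S. A i k \<cdot> leibniz S (A(i := unit_row k)))"
proof -
  have term_expand: "product (\<lambda>j. A (\<pi> j) j) S =
      (\<Sum>k\<in>S. A i k \<cdot> product (\<lambda>j. (A(i := unit_row k)) (\<pi> j) j) S)" if p: "\<pi> permutes S" for \<pi>
  proof -
    \<comment> \<open>Only the column that \<open>\<pi>\<close> sends to row \<open>i\<close> contributes to the term of \<open>\<pi>\<close>.\<close>
    define m where "m = inv_into UNIV \<pi> i"
    have m: "m \<in> S" and pm: "\<pi> m = i"
      using i p by (simp_all add: m_def permutes_in_image permutes_inv permutes_inverses(1))
    have off: "\<pi> j \<noteq> i" if "j \<noteq> m" for j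
      using p pm that by (metis permutes_inj injD)
    have "(\<Sum>k\<in>S. A i k \<cdot> product (\<lambda>j. (A(i := unit_row k)) (\<pi> j) j) S) =
        (\<Sum>k\<in>S. if k = m then A i m \<cdot> product (\<lambda>j. (A(i := unit_row m)) (\<pi> j) j) S else 0)"
      using off by (intro sum.cong refl) (auto simp: product_unit_row_zero S p i mult_zero_right
          simp del: fun_upd_apply)
    also have "\<dots> = A i m \<cdot> product (\<lambda>j. (A(i := unit_row m)) (\<pi> j) j) S"
      using S m by simp
    also have "product (\<lambda>j. (A(i := unit_row m)) (\<pi> j) j) S =
        product (\<lambda>j. (A(i := unit_row m)) (\<pi> j) j) (S - {m})"
      by (subst pair_mult.remove[OF S m]) (simp add: pm mult_one_left)
    also have "\<dots> = product (\<lambda>j. A (\<pi> j) j) (S - {m})"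
      using off by (intro pair_mult.cong) auto
    also have "A i m \<cdot> \<dots> = product (\<lambda>j. A (\<pi> j) j) S"
      by (subst pair_mult.remove[OF S m]) (simp add: pm)
    finally show ?thesis by simp
  qed
  have "leibniz S A = (\<Sum>\<pi> | \<pi> permutes S. \<Sum>k\<in>S. A i k \<cdot>
      (if evenperm \<pi> then id else neg) (product (\<lambda>j. (A(i := unit_row k)) (\<pi> j) j) S))"
    unfolding leibniz_def
    by (intro sum.cong refl) (simp add: term_expand neg_sum neg_mult_right del: fun_upd_apply)
  also have "\<dots> = (\<Sum>k\<in>S. A i k \<cdot> leibniz S (A(i := unit_row k)))"
    unfolding leibniz_def mult_sum_right by (rule sum.swap)
  finally show ?thesis .
qed

lemma leibniz_column_linear:
  assumes S: "finite S" and k: "k \<in> S"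
    and column: "\<And>i. A i k = u \<cdot> B i k + v \<cdot> C i k"
    and others: "\<And>i j. j \<noteq> k \<Longrightarrow> B i j = A i j" "\<And>i j. j \<noteq> k \<Longrightarrow> C i j = A i j"
  shows "leibniz S A = u \<cdot> leibniz S B + v \<cdot> leibniz S C"
proof -
  have "product (\<lambda>j. A (\<pi> j) j) S =
      u \<cdot> product (\<lambda>j. B (\<pi> j) j) S + v \<cdot> product (\<lambda>j. C (\<pi> j) j) S" for \<pi>
  proof -
    let ?Q = "product (\<lambda>j. A (\<pi> j) j) (S - {k})"
    have "product (\<lambda>j. B (\<pi> j) j) (S - {k}) = ?Q" "product (\<lambda>j. C (\<pi> j) j) (S - {k}) = ?Q"
      by (intro pair_mult.cong; simp add: others)+
    then show ?thesis
      by (simp add: pair_mult.remove[OF S k] column mult_add_left mult_assoc)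
  qed
  then show ?thesis
    unfolding leibniz_def mult_sum_right sum.distrib[symmetric]
    by (intro sum.cong refl) (simp add: neg_add neg_mult_right)
qed

lemma leibniz_zero_column:
  assumes S: "finite S" and k: "k \<in> S" and zero: "\<And>i. i \<in> S \<Longrightarrow> A i k = 0"
  shows "leibniz S A = 0"
  unfolding leibniz_def
proof (intro sum.neutral ballI)
  fix \<pi>
  assume "\<pi> \<in> {\<pi>. \<pi> permutes S}"
  then have "product (\<lambda>j. A (\<pi> j) j) S = 0"
    by (intro product_zero[OF S k]) (simp add: permutes_in_image k zero)
  then show "(if evenperm \<pi> then id else neg) (product (\<lambda>j. A (\<pi> j) j) S) = 0"
    by (simp add: neg_zero)
qed

text \<open>
  A unit row at \<open>j\<close> makes the other entries of column \<open>j\<close> irrelevant. Up to irrelevant entries, the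
  matrix on the left therefore arises from the one on the right by interchanging the columns
  \<open>j\<close> and \<open>k\<close>.
\<close>

lemma leibniz_move_unit_row:
  assumes S: "finite S" and i: "i \<in> S" and j: "j \<in> S" and k: "k \<in> S" and jk: "j \<noteq> k"
  shows "leibniz S ((\<lambda>r. (A r)(k := A r j))(i := unit_row j)) = neg (leibniz S (A(i := unit_row k)))"
    (is "leibniz S ?N = neg (leibniz S ?M)")
proof -
  let ?t = "transpose j k"
  have t: "?t permutes S" using j k by (rule permutes_swap_id)
  have "leibniz S ?N = (\<Sum>\<pi> | \<pi> permutes S.
      (if evenperm (\<pi> \<circ> ?t) then id else neg) (product (\<lambda>l. ?N ((\<pi> \<circ> ?t) l) l) S))"
    unfolding leibniz_def by (rule sum_permutations_compose_right[OF t])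
  also have "\<dots> = (\<Sum>\<pi> | \<pi> permutes S.
      neg ((if evenperm \<pi> then id else neg) (product (\<lambda>l. ?M (\<pi> l) l) S)))"
  proof (intro sum.cong refl)
    fix \<pi>
    assume "\<pi> \<in> {\<pi>. \<pi> permutes S}"
    then have p: "\<pi> permutes S" by simp
    have sgn: "evenperm (\<pi> \<circ> ?t) \<longleftrightarrow> \<not> evenperm \<pi>"
      using S p t jk by (subst evenperm_comp) (auto simp: permutation_permutes evenperm_swap)
    have "product (\<lambda>l. ?N ((\<pi> \<circ> ?t) l) l) S = product (\<lambda>l. ?M (\<pi> l) l) S"
    proof (cases "\<pi> k = i")
      case False
      then have "(\<pi> \<circ> ?t) j \<noteq> i" by simp
      then have "product (\<lambda>l. ?N ((\<pi> \<circ> ?t) l) l) S = 0"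
        by (rule product_unit_row_zero[OF S permutes_compose[OF t p] i])
      moreover have "product (\<lambda>l. ?M (\<pi> l) l) S = 0"
        by (rule product_unit_row_zero[OF S p i False])
      ultimately show ?thesis by simp
    next
      case True
      then have off: "\<pi> l \<noteq> i" if "l \<noteq> k" for l
        using p that by (metis permutes_inj injD)
      have jS: "j \<in> S - {k}" using j jk by simp
      have rest: "product (\<lambda>l. ?N ((\<pi> \<circ> ?t) l) l) (S - {k} - {j}) =
          product (\<lambda>l. ?M (\<pi> l) l) (S - {k} - {j})"
        using off by (intro pair_mult.cong) (auto simp: transpose_def)
      have "product (\<lambda>l. ?N ((\<pi> \<circ> ?t) l) l) S =
          A (\<pi> j) j \<cdot> (emb 1 \<cdot> product (\<lambda>l. ?N ((\<pi> \<circ> ?t) l) l) (S - {k} - {j}))"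
        by (subst pair_mult.remove[OF S k], subst pair_mult.remove[OF _ jS])
          (use S jk off True in simp_all)
      also have "\<dots> = product (\<lambda>l. ?M (\<pi> l) l) S"
        unfolding rest
        by (subst pair_mult.remove[OF S k], subst pair_mult.remove[OF _ jS])
          (use S jk off True in \<open>simp_all add: mult_one_left\<close>)
      finally show ?thesis .
    qed
    then show "(if evenperm (\<pi> \<circ> ?t) then id else neg) (product (\<lambda>l. ?N ((\<pi> \<circ> ?t) l) l) S) =
        neg ((if evenperm \<pi> then id else neg) (product (\<lambda>l. ?M (\<pi> l) l) S))"
      using sgn by (simp only:) (simp add: neg_neg)
  qed
  also have "\<dots> = neg (leibniz S ?M)"
    by (simp only: leibniz_def neg_sum)
  finally show ?thesis .
qed

end

section \<open>Multiples\<close>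

primrec copies :: "nat \<Rightarrow> 'a::comm_monoid_add \<Rightarrow> 'a"
  where "copies 0 b = 0" | "copies (Suc n) b = b + copies n b"

lemma copies_add: "copies (m + n) b = copies m b + copies n b"
  by (induction m) (simp_all add: add.assoc)

lemma copies_zero [simp]: "copies n 0 = 0"
  by (induction n) simp_all

lemma copies_sum: "(\<Sum>k\<in>K. copies (p k) b) = copies (\<Sum>k\<in>K. p k) b"
  by (induction K rule: infinite_finite_induct) (simp_all add: copies_add)

lemma copies_absorb: "b + c = c \<Longrightarrow> copies n b + c = c"
  by (induction n) (simp_all add: add.assoc)

lemma (in admissible_pair) copies_mult_right: "b \<cdot> copies n c = copies n (b \<cdot> c)"
  by (induction n) (simp_all add: mult_zero_right mult_add_right)

lemma (in admissible_pair) copies_mult_left: "copies n b \<cdot> c = copies n (b \<cdot> c)"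
  by (metis copies_mult_right mult_commute)

lemma (in admissible_pair) copies_mult_copies: "copies m b \<cdot> copies n c = copies (m * n) (b \<cdot> c)"
proof -
  have "copies n (copies m d) = copies (m * n) d" for d :: 'b
    by (induction n) (simp_all add: copies_add)
  then show ?thesis by (simp add: copies_mult_left copies_mult_right)
qed

section \<open>Sums in uniquely negated metatangible pairs\<close>

context uniquely_negated_metatangible_pair
begin

abbreviation quasi where "quasi a \<equiv> emb a + neg (emb a)"

lemma tangible_sum:
  assumes "emb b \<noteq> neg (emb a)"
  obtains t where "emb a + emb b = emb t"
  using assms sum_T[of a b] unique_neg[of a b] by auto

text \<open>
  Adding \<open>(-)b\<close> on both sides shows that \<open>t + (-)b\<close> is a sum of two elements \<open>c\<degree>\<close>, hence lies in
  \<open>\<A>\<^sub>0\<close>; negatives being unique, \<open>t = b\<close>.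
\<close>

lemma quasi_add_tangible_eq:
  assumes "quasi a + emb b = emb t"
  shows "t = b"
proof -
  obtain b' where b': "neg (emb b) = emb b'" by (rule neg_emb)
  have "emb b' + emb t = quasi a + (emb b + neg (emb b))"
    by (simp add: b' assms[symmetric] add_ac)
  then have "emb b' + emb t \<in> A0" by (metis A0_add quasi_zero)
  then have "emb t = neg (emb b')" by (rule unique_neg)
  then have "emb t = emb b" by (simp add: b'[symmetric] neg_neg)
  then show ?thesis using inj_emb by (simp add: inj_eq)
qed

lemma quasi_add_distinct:
  assumes "b \<noteq> a"
  shows "quasi a + emb b \<in> {emb b, quasi a}"
proof -
  obtain a' where a': "neg (emb a) = emb a'" by (rule neg_emb)
  have "emb b \<noteq> neg (emb a')"
    using assms by (metis a' neg_neg emb_eq_iff)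
  then obtain t where t: "emb a' + emb b = emb t" by (rule tangible_sum)
  show ?thesis
  proof (cases "emb t = neg (emb a)")
    case True
    then show ?thesis by (metis a' add.assoc insertI1 insertI2 t)
  next
    case False
    then obtain s where "emb a + emb t = emb s" by (rule tangible_sum)
    then have s: "quasi a + emb b = emb s" by (simp add: a' t[symmetric] add_ac)
    then show ?thesis using quasi_add_tangible_eq by auto
  qed
qed

text \<open>
  Since \<open>a\<degree> = ((-)a)\<degree>\<close>, the case \<open>b = a\<close> reduces to that of distinct elements whenever \<open>(-)a\<close>
  differs from \<open>a\<close>.
\<close>

lemma quasi_add:
  assumes "b \<noteq> a \<or> neg (emb a) \<noteq> emb a"
  shows "quasi a + emb b \<in> {emb b, quasi a}"
proof (cases "b = a")
  case False
  then show ?thesis by (rule quasi_add_distinct)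
next
  case True
  obtain a' where a': "neg (emb a) = emb a'" by (rule neg_emb)
  then have "b \<noteq> a'" using True assms by auto
  then have "quasi a' + emb b \<in> {emb b, quasi a'}" by (rule quasi_add_distinct)
  moreover have "quasi a' = quasi a" by (simp add: a'[symmetric] neg_neg add.commute)
  ultimately show ?thesis by simp
qed

end

section \<open>Elimination when every element is tangible or quasi-zero\<close>

text \<open>
  The case without exception. It includes integral domains (with \<open>\<A>\<^sub>0 = {0}\<close>), where \<open>a\<degree> + b = b\<close>
  always holds, and the supertropical semiring, where \<open>a\<degree> + a = a\<degree>\<close>.
\<close>

locale quasi_absorbing_pair = uniquely_negated_metatangible_pair +
  assumes quasi_add_any: "emb a + neg (emb a) + emb b \<in> {emb b, emb a + neg (emb a)}"
begin

lemma tangible_or_quasi: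
  obtains "b = 0" | a where "b = emb a" | a where "b = quasi a"
proof -
  obtain bs where b: "b = (\<Sum>a\<leftarrow>bs. emb a)" by (rule T_spans)
  have "(\<Sum>a\<leftarrow>bs. emb a) \<in> insert 0 (range emb) \<union> range quasi"
  proof (induction bs)
    case Nil
    then show ?case by simp
  next
    case (Cons a bs)
    then consider "(\<Sum>a\<leftarrow>bs. emb a) = 0" | c where "(\<Sum>a\<leftarrow>bs. emb a) = emb c"
      | c where "(\<Sum>a\<leftarrow>bs. emb a) = quasi c"
      by auto
    then show ?case
    proof cases
      case 1
      then show ?thesis by simp
    next
      case (2 c)
      then show ?thesis using sum_T[of a c] property_N[of a c] by auto
    next
      case (3 c)
      then show ?thesis using quasi_add_any[of c a] by (auto simp: add.commute)
    qed
  qed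
  then show thesis using b that by auto
qed

lemma in_A0_cases:
  assumes "b \<in> A0"
  obtains "b = 0" | a where "b = quasi a"
  using assms emb_notin_A0 tangible_or_quasi by metis

lemma notin_A0:
  assumes "b \<notin> A0"
  obtains a where "b = emb a"
  using assms A0_zero quasi_zero tangible_or_quasi by metis

lemma neg_A0: "b \<in> A0 \<Longrightarrow> neg b = b"
  by (erule in_A0_cases) (simp_all add: neg_zero neg_add neg_neg add.commute)

lemma tangible_absorbed:
  assumes "emb y + z \<in> A0" "z \<in> A0"
  shows "emb y + z = z"
  using \<open>z \<in> A0\<close>
proof (cases rule: in_A0_cases)
  case 1
  then show ?thesis using assms emb_notin_A0 by simp
next
  case (2 a)
  then show ?thesis using assms(1) quasi_add_any[of a y] emb_notin_A0 by (auto simp: add.commute)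
qed

text \<open>
  This is transitivity of the balance relation through the tangible middle term \<open>y\<close>. If \<open>z\<close> is tangible
  as well, unique negation gives \<open>z = y\<close>. Otherwise \<open>z\<close> lies in \<open>\<A>\<^sub>0\<close> and absorbs \<open>y\<close>, so that
  \<open>u + a z = (u + a y) + a z\<close>, unless \<open>u\<close> itself is in \<open>\<A>\<^sub>0\<close>.
\<close>

lemma substitute_balanced:
  assumes y: "y \<in> insert 0 (range emb)" and yz: "y + neg z \<in> A0" and uy: "u + a \<cdot> y \<in> A0"
  shows "u + a \<cdot> z \<in> A0"
proof (cases "z \<in> A0")
  case False
  then obtain s where s: "z = emb s" by (rule notin_A0)
  obtain s' where s': "neg (emb s) = emb s'" by (rule neg_emb)
  have "y \<noteq> 0" using yz False by (auto simp: A0_neg_iff)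
  then obtain t where t: "y = emb t" using y by auto
  have "emb s' = neg (emb t)" using unique_neg[of t s'] yz by (simp add: s t s')
  then have "z = y" by (metis s s' t neg_neg)
  then show ?thesis using uy by simp
next
  case True
  show ?thesis
  proof (cases "u \<in> A0")
    case True
    then show ?thesis using \<open>z \<in> A0\<close> by (simp add: A0_add A0_mult_right)
  next
    case False
    then have "y \<noteq> 0" using uy by (auto simp: mult_zero_right)
    then obtain t where "y = emb t" using y by auto
    then have "y + z = z" using tangible_absorbed[of t z] yz True by (simp add: neg_A0)
    then have "u + a \<cdot> z = (u + a \<cdot> y) + a \<cdot> z"
      by (metis add.assoc mult_add_right)
    then show ?thesis using uy True by (simp add: A0_add A0_mult_right)
  qed
qed

lemma substitute_balanced_sum:
  assumes "finite F" "\<And>k. k \<in> F \<Longrightarrow> y k \<in> insert 0 (range emb)"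
    "\<And>k. k \<in> F \<Longrightarrow> y k + neg (z k) \<in> A0" "u + (\<Sum>k\<in>F. a k \<cdot> y k) \<in> A0"
  shows "u + (\<Sum>k\<in>F. a k \<cdot> z k) \<in> A0"
  using assms
proof (induction F arbitrary: u)
  case empty
  then show ?case by simp
next
  case (insert k F)
  have "(u + a k \<cdot> y k) + (\<Sum>k\<in>F. a k \<cdot> z k) \<in> A0"
    by (rule insert.IH) (use insert in \<open>auto simp: add_ac\<close>)
  then have "(u + (\<Sum>k\<in>F. a k \<cdot> z k)) + a k \<cdot> y k \<in> A0" by (simp add: add_ac)
  then have "(u + (\<Sum>k\<in>F. a k \<cdot> z k)) + a k \<cdot> z k \<in> A0"
    by (rule substitute_balanced[rotated 2]) (use insert.prems in auto)
  then show ?case using insert by (simp add: add_ac)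
qed

text \<open>
  Any \<open>j\<close> with \<open>M\<^sub>j \<notin> \<A>\<^sub>0\<close> will do, because then \<open>M\<^sub>j\<close> is tangible. If \<open>\<Sum>\<^sub>k a\<^sub>k x\<^sub>k\<close> were in \<open>\<A>\<^sub>0\<close>, multiply
  it by \<open>M\<^sub>j\<close> and replace each \<open>x\<^sub>k M\<^sub>j\<close>, which is tangible or zero, by the balanced element
  \<open>x\<^sub>j M\<^sub>k\<close>; the result is \<open>x\<^sub>j (\<Sum>\<^sub>k a\<^sub>k M\<^sub>k)\<close>.
\<close>

lemma exchange_absorbing:
  assumes K: "finite K" and x: "\<And>k. k \<in> K \<Longrightarrow> x k \<in> insert 0 (range emb)"
    and aM: "(\<Sum>k\<in>K. a k \<cdot> M k) \<notin> A0"
  shows "\<exists>j\<in>K. M j \<notin> A0 \<and> (x j \<noteq> 0 \<longrightarrow>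
    (\<forall>k\<in>K - {j}. x k \<cdot> M j + x j \<cdot> neg (M k) \<in> A0) \<longrightarrow> (\<Sum>k\<in>K. a k \<cdot> x k) \<notin> A0)"
proof -
  have "\<exists>j\<in>K. M j \<notin> A0"
  proof (rule ccontr)
    assume "\<not> (\<exists>j\<in>K. M j \<notin> A0)"
    then have "(\<Sum>k\<in>K. a k \<cdot> M k) \<in> A0" by (intro A0_sum A0_mult_right) simp
    then show False using aM by simp
  qed
  then obtain j where j: "j \<in> K" "M j \<notin> A0" by blast
  from j(2) obtain m where m: "M j = emb m" by (rule notin_A0)
  have "(\<Sum>k\<in>K. a k \<cdot> x k) \<notin> A0"
    if xj: "x j \<noteq> 0" and cross: "\<And>k. k \<in> K - {j} \<Longrightarrow> x k \<cdot> M j + x j \<cdot> neg (M k) \<in> A0"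
  proof
    assume "(\<Sum>k\<in>K. a k \<cdot> x k) \<in> A0"
    then have "(\<Sum>k\<in>K. a k \<cdot> x k) \<cdot> M j \<in> A0" by (rule A0_mult_left)
    then have "(\<Sum>k\<in>K. a k \<cdot> (x k \<cdot> M j)) \<in> A0"
      by (simp add: mult_commute[of _ "M j"] mult_sum_right pair_mult.left_commute[of "M j"])
    then have "a j \<cdot> (x j \<cdot> M j) + (\<Sum>k\<in>K - {j}. a k \<cdot> (x k \<cdot> M j)) \<in> A0"
      by (simp add: sum.remove[OF K j(1)])
    then have "a j \<cdot> (x j \<cdot> M j) + (\<Sum>k\<in>K - {j}. a k \<cdot> (x j \<cdot> M k)) \<in> A0"
    proof (rule substitute_balanced_sum[rotated 3])
      show "x k \<cdot> M j \<in> insert 0 (range emb)" if "k \<in> K - {j}" for k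
        using x[of k] that by (auto simp: m mult_zero_left emb_mult_emb)
    qed (use cross K in \<open>auto simp: neg_mult_right\<close>)
    then have "(\<Sum>k\<in>K. a k \<cdot> (x j \<cdot> M k)) \<in> A0"
      by (simp add: sum.remove[OF K j(1)])
    then have "x j \<cdot> (\<Sum>k\<in>K. a k \<cdot> M k) \<in> A0"
      by (simp add: mult_sum_right pair_mult.left_commute[of "x j"])
    then show False using aM x[OF j(1)] xj emb_mult_in_A0 by auto
  qed
  with j show ?thesis by blast
qed

end

section \<open>Layered pairs\<close>

text \<open>
  The exceptional case. A typical instance consists of pairs of a multiplicity in \<open>\<nat>\<^sup>+\<close> and an element
  of a totally ordered cancellative monoid, together with zero: the larger element wins in a sum, and multiplicities
  are added in case of a tie. Here \<open>\<A>\<^sub>0\<close> contains the elements of even multiplicity, and it may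
  contain those of odd multiplicity from some bound on. An element outside \<open>\<A>\<^sub>0\<close> need not be tangible,
  so the elimination of the first case is not available.
\<close>

locale layered_pair = uniquely_negated_metatangible_pair +
  assumes neg_one: "neg (emb 1) = emb 1"
    and three_neq_one: "emb 1 + emb 1 + emb 1 \<noteq> emb 1"
begin

lemma neg_id: "neg b = b"
  by (metis neg_eq_mult neg_one mult_one_left)

lemma double_in_A0: "b + b \<in> A0"
  using quasi_zero[of b] by (simp add: neg_id)

lemma emb_add_in_A0: "emb a + emb b \<in> A0 \<Longrightarrow> a = b"
  using unique_neg[of a b] inj_emb by (simp add: neg_id inj_eq)

lemma three_neq: "emb a + emb a + emb a \<noteq> emb a"
proof
  assume *: "emb a + emb a + emb a = emb a"
  have "emb a \<cdot> (emb 1 + emb 1 + emb 1) = emb a \<cdot> emb 1"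
    by (simp add: mult_add_right mult_one_right *)
  then show False using three_neq_one emb_mult_cancel by blast
qed

text \<open>
  By \<open>quasi_add_distinct\<close>, \<open>2a + b\<close> is \<open>b\<close> or \<open>2a\<close>. If it is \<open>2a\<close>, the tangible element \<open>c = a + b\<close> satisfies
  \<open>a + c = 2a \<in> \<A>\<^sub>0\<close>, so \<open>c = a\<close>. By symmetry \<open>c = b\<close> if \<open>2b + a = 2b\<close>. In the remaining case
  \<open>2a = 2a + 2b = 2b\<close>, whence \<open>3a = 2b + a = a\<close>, which is excluded.
\<close>

lemma bipotent: "a \<noteq> b \<Longrightarrow> emb a + emb b = emb a \<or> emb a + emb b = emb b"
proof -
  assume ab: "a \<noteq> b"
  then have "emb b \<noteq> neg (emb a)" using inj_emb by (auto simp: neg_id inj_eq)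
  then obtain c where c: "emb a + emb b = emb c" by (rule tangible_sum)
  have "emb a + emb a + emb b = emb b \<or> emb a + emb a + emb b = emb a + emb a"
    using quasi_add_distinct[of b a] ab by (auto simp: neg_id)
  moreover have "emb b + emb b + emb a = emb a \<or> emb b + emb b + emb a = emb b + emb b"
    using quasi_add_distinct[of a b] ab by (auto simp: neg_id)
  moreover have "a = c" if "emb a + emb a + emb b = emb a + emb a"
  proof (rule emb_add_in_A0)
    have "emb a + emb c = emb a + emb a" using that by (simp add: c[symmetric] add_ac)
    then show "emb a + emb c \<in> A0" by (simp add: double_in_A0)
  qed
  moreover have "b = c" if "emb b + emb b + emb a = emb b + emb b"
  proof (rule emb_add_in_A0)
    have "emb b + emb c = emb b + emb b" using that by (simp add: c[symmetric] add_ac)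
    then show "emb b + emb c \<in> A0" by (simp add: double_in_A0)
  qed
  moreover have False if 1: "emb a + emb a + emb b = emb b" and 2: "emb b + emb b + emb a = emb a"
  proof -
    have "emb a + emb a = emb b + (emb b + emb a + emb a)"
      using 2 by (metis add.assoc add.commute)
    also have "\<dots> = emb b + emb b" using 1 by (simp add: add_ac)
    finally show False using 2 three_neq[of a] by simp
  qed
  ultimately show ?thesis using c by auto
qed

definition below where "below a b \<longleftrightarrow> a = b \<or> emb a + emb b = emb b"

lemma below_refl: "below a a"
  by (simp add: below_def)

lemma below_total: "below a b \<or> below b a"
  using bipotent[of a b] by (auto simp: below_def add.commute)

lemma below_trans: "below a b \<Longrightarrow> below b c \<Longrightarrow> below a c"
  unfolding below_def by (metis add.assoc)

lemma below_antisym: "below a b \<Longrightarrow> below b a \<Longrightarrow> a = b"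
proof -
  assume "below a b" "below b a"
  then have "a = b \<or> emb a = emb b" by (auto simp: below_def add.commute)
  then show ?thesis by (simp add: emb_eq_iff)
qed

lemma below_mult: "below a b \<Longrightarrow> below (c * a) (c * b)"
  unfolding below_def by (metis emb_mult_emb mult_add_right)

lemma mult_cancel:
  fixes a b c :: 'a
  shows "c * a = c * b \<Longrightarrow> a = b"
  using emb_mult_cancel[of c "emb a" "emb b"] by (simp add: emb_mult_emb emb_eq_iff)

lemma exists_top:
  assumes "finite K" "K \<noteq> {}"
  shows "\<exists>j\<in>K. \<forall>k\<in>K. below (t k) (t j)"
  using assms
proof (induction rule: finite_ne_induct)
  case (singleton k)
  then show ?case by (simp add: below_refl)
next
  case (insert k F)
  then obtain j where "j \<in> F" "\<forall>k\<in>F. below (t k) (t j)" by blast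
  then show ?case using below_total[of "t k" "t j"] below_refl below_trans by blast
qed

lemma copies_of_tangible: obtains n a where "b = copies n (emb a)"
proof -
  obtain bs where b: "b = (\<Sum>a\<leftarrow>bs. emb a)" by (rule T_spans)
  have "\<exists>n a. (\<Sum>a\<leftarrow>bs. emb a) = copies n (emb a)"
  proof (induction bs)
    case Nil
    show ?case by (intro exI[of _ 0]) simp
  next
    case (Cons a bs)
    then obtain n c where n: "(\<Sum>a\<leftarrow>bs. emb a) = copies n (emb c)" by blast
    show ?case
    proof (cases n)
      case 0
      then show ?thesis by (intro exI[of _ 1] exI[of _ a]) (simp add: n)
    next
      case (Suc n')
      have "emb a + copies n (emb c) \<in> {copies (Suc n) (emb c), copies n (emb c), copies 1 (emb a)}"
      proof -
        have "emb a + copies n (emb c) = emb a" if "emb c + emb a = emb a"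
          using copies_absorb[OF that, of n] by (simp add: add.commute)
        moreover have "emb a + copies n (emb c) = copies n (emb c)" if "emb a + emb c = emb c"
          using that by (simp add: Suc add.assoc[symmetric])
        ultimately show ?thesis using bipotent[of a c] by (auto simp: add.commute)
      qed
      then show ?thesis by (simp only: list.map sum_list.Cons n) blast
    qed
  qed
  then show thesis using b that by blast
qed

lemma copies_add_dominated:
  assumes "below s t" "s \<noteq> t" "n > 0"
  shows "copies m (emb s) + copies n (emb t) = copies n (emb t)"
proof -
  have "emb s + emb t = emb t" using assms by (simp add: below_def)
  then have "copies m (emb s) + emb t = emb t" by (rule copies_absorb)
  moreover obtain n' where "n = Suc n'" using \<open>n > 0\<close> gr0_conv_Suc by blast
  ultimately show ?thesis by (simp add: add.assoc[symmetric])
qed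

text \<open>
  Terms of multiplicity 0 are exempt from the bound by \<open>c\<close>, because their tangible part is meaningless.
\<close>

lemma sum_copies_top:
  assumes K: "finite K" and top: "\<And>k. k \<in> K \<Longrightarrow> p k > 0 \<Longrightarrow> below (t k) c"
    and pos: "(\<Sum>k | k \<in> K \<and> t k = c. p k) > 0"
  shows "(\<Sum>k\<in>K. copies (p k) (emb (t k))) = copies (\<Sum>k | k \<in> K \<and> t k = c. p k) (emb c)"
proof -
  let ?n = "\<Sum>k | k \<in> K \<and> t k = c. p k"
  have absorbed: "(\<Sum>k\<in>F. copies (p k) (emb (t k))) + copies ?n (emb c) = copies ?n (emb c)"
    if "finite F" "F \<subseteq> {k\<in>K. t k \<noteq> c}" for F
    using that
  proof (induction F)
    case empty
    then show ?case by simp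
  next
    case (insert k F)
    have "copies (p k) (emb (t k)) + copies ?n (emb c) = copies ?n (emb c)"
    proof (cases "p k = 0")
      case True
      then show ?thesis by simp
    next
      case False
      then show ?thesis using insert.prems top[of k] pos copies_add_dominated by simp
    qed
    then show ?case using insert by (simp add: add.assoc)
  qed
  have "(\<Sum>k\<in>K. copies (p k) (emb (t k))) =
      (\<Sum>k | k \<in> K \<and> t k \<noteq> c. copies (p k) (emb (t k))) +
      (\<Sum>k | k \<in> K \<and> t k = c. copies (p k) (emb (t k)))"
    using K by (subst sum.union_disjoint[symmetric]) (auto intro!: sum.cong)
  also have "(\<Sum>k | k \<in> K \<and> t k = c. copies (p k) (emb (t k))) = copies ?n (emb c)"
    by (simp add: copies_sum)
  also have "(\<Sum>k | k \<in> K \<and> t k \<noteq> c. copies (p k) (emb (t k))) + \<dots> = \<dots>"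
    using K by (intro absorbed) auto
  finally show ?thesis .
qed

lemma copies_in_A0_transfer: "copies n (emb a) \<in> A0 \<Longrightarrow> copies n (emb b) \<in> A0"
proof -
  assume "copies n (emb a) \<in> A0"
  then have "emb a \<cdot> copies n (emb 1) \<in> A0" by (simp add: copies_mult_right mult_one_right)
  then have "emb b \<cdot> copies n (emb 1) \<in> A0" by (metis emb_mult_in_A0 A0_mult_right)
  then show ?thesis by (simp add: copies_mult_right mult_one_right)
qed

lemma even_copies_in_A0: "even n \<Longrightarrow> copies n b \<in> A0"
proof -
  assume "even n"
  then obtain m where "n = m + m" by (metis evenE mult_2)
  then show ?thesis by (simp add: copies_add double_in_A0)
qed

text \<open>
  The multiplicities of the elements of \<open>\<A>\<^sub>0\<close> are closed under addition and include 2. Hence an odd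
  one forces all larger odd numbers to be among them.
\<close>

lemma copies_in_A0_iff_even:
  assumes N: "copies N (emb c) \<notin> A0" and n: "n \<le> N"
  shows "copies n (emb b) \<in> A0 \<longleftrightarrow> even n"
proof
  assume b: "copies n (emb b) \<in> A0"
  show "even n"
  proof (rule ccontr)
    assume "odd n"
    moreover have "odd N" using N even_copies_in_A0 by blast
    ultimately have "copies (N - n) (emb c) \<in> A0" using n by (intro even_copies_in_A0) simp
    then have "copies (n + (N - n)) (emb c) \<in> A0"
      unfolding copies_add by (intro A0_add copies_in_A0_transfer[OF b])
    then show False using N n by simp
  qed
qed (rule even_copies_in_A0)

text \<open>
  Write \<open>a\<^sub>k = p\<^sub>k g\<^sub>k\<close> and \<open>M\<^sub>k = r\<^sub>k f\<^sub>k\<close> with multiplicities \<open>p\<^sub>k\<close>, \<open>r\<^sub>k\<close> and tangible \<open>g\<^sub>k\<close>, \<open>f\<^sub>k\<close>. If \<open>c\<close> is the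
  largest of the \<open>g\<^sub>k f\<^sub>k\<close>, the sum of the \<open>a\<^sub>k M\<^sub>k\<close> is \<open>N c\<close>, where \<open>N\<close> is the sum of the \<open>p\<^sub>k r\<^sub>k\<close> over the
  indices at which \<open>c\<close> is attained. As it is not in \<open>\<A>\<^sub>0\<close>, \<open>N\<close> is odd, and up to \<open>N\<close> only
  even multiplicities belong to \<open>\<A>\<^sub>0\<close>. Choose \<open>j\<close> with \<open>g\<^sub>j f\<^sub>j = c\<close> and \<open>p\<^sub>j r\<^sub>j\<close> odd. The assumption
  \<open>x\<^sub>k M\<^sub>j + x\<^sub>j M\<^sub>k \<in> \<A>\<^sub>0\<close> then shows that \<open>f\<^sub>j x\<^sub>k \<le> f\<^sub>k x\<^sub>j\<close>, since \<open>r\<^sub>j\<close> is a multiplicity outside \<open>\<A>\<^sub>0\<close>.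
  Consequently the sum of the \<open>f\<^sub>j a\<^sub>k x\<^sub>k\<close> has the largest tangible part \<open>c x\<^sub>j\<close>, attained at a set \<open>Q\<close> of
  indices at which \<open>c\<close> is attained too. For \<open>k \<noteq> j\<close> in \<open>Q\<close> both summands of the assumption tie, so
  \<open>r\<^sub>k\<close> is odd; for the other \<open>k\<close> attaining \<open>c\<close> with \<open>p\<^sub>k > 0\<close> the second summand dominates or stands
  alone, so \<open>r\<^sub>k\<close> is even. Therefore the sum of the \<open>p\<^sub>k\<close> over \<open>Q\<close> has the parity of \<open>N\<close> and is at
  most \<open>N\<close>: it is a multiplicity outside \<open>\<A>\<^sub>0\<close>.
\<close>

lemma exchange_layered:
  assumes K: "finite K" and x: "\<And>k. k \<in> K \<Longrightarrow> x k \<in> insert 0 (range emb)"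
    and aM: "(\<Sum>k\<in>K. a k \<cdot> M k) \<notin> A0"
  shows "\<exists>j\<in>K. M j \<notin> A0 \<and> (x j \<noteq> 0 \<longrightarrow>
    (\<forall>k\<in>K - {j}. x k \<cdot> M j + x j \<cdot> neg (M k) \<in> A0) \<longrightarrow> (\<Sum>k\<in>K. a k \<cdot> x k) \<notin> A0)"
proof -
  \<comment> \<open>Zero has multiplicity 0 and an arbitrary tangible part.\<close>
  have "\<forall>k. \<exists>n t. a k = copies n (emb t)" using copies_of_tangible by metis
  then obtain p g where a: "\<And>k. a k = copies (p k) (emb (g k))" by metis
  have "\<forall>k. \<exists>n t. M k = copies n (emb t)" using copies_of_tangible by metis
  then obtain r f where M: "\<And>k. M k = copies (r k) (emb (f k))" by metis
  have "\<forall>k. \<exists>t. k \<in> K \<longrightarrow> x k \<noteq> 0 \<longrightarrow> x k = emb t" using x by blast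
  then obtain \<xi> where \<xi>: "\<And>k. k \<in> K \<Longrightarrow> x k \<noteq> 0 \<Longrightarrow> x k = emb (\<xi> k)" by metis

  let ?K = "{k\<in>K. p k * r k > 0}"
  have "?K \<noteq> {}"
  proof
    assume "?K = {}"
    then have "p k = 0 \<or> r k = 0" if "k \<in> K" for k using that by auto
    then have "(\<Sum>k\<in>K. a k \<cdot> M k) = 0"
      by (intro sum.neutral ballI) (fastforce simp: a M mult_zero_left mult_zero_right)
    then show False using aM A0_zero by simp
  qed
  then obtain i where i: "i \<in> ?K" and i_top: "\<And>k. k \<in> ?K \<Longrightarrow> below (g k * f k) (g i * f i)"
    using exists_top[of ?K "\<lambda>k. g k * f k"] K by auto
  define c where "c = g i * f i"
  define Top where "Top = {k. k \<in> K \<and> g k * f k = c}"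
  have finTop: "finite Top" using K by (simp add: Top_def)
  define N where "N = (\<Sum>k\<in>Top. p k * r k)"
  have le_N: "p k * r k \<le> N" if "k \<in> Top" for k
    unfolding N_def using finTop that by (intro member_le_sum) auto
  have "i \<in> Top" using i by (simp add: Top_def c_def)
  moreover have "p i * r i > 0" using i by simp
  ultimately have "N > 0" using le_N[of i] by linarith
  then have "(\<Sum>k\<in>K. a k \<cdot> M k) = copies N (emb c)"
    unfolding N_def Top_def a M copies_mult_copies emb_mult_emb
    by (intro sum_copies_top[OF K]) (use i_top in \<open>auto simp: c_def\<close>)
  then have N: "copies N (emb c) \<notin> A0" using aM by simp
  note parity = copies_in_A0_iff_even[OF N]

  have "odd N" using N even_copies_in_A0 by blast
  then obtain j where j: "j \<in> Top" and odd_j: "odd (p j * r j)"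
    unfolding N_def by (meson dvd_sum)
  then have jK: "j \<in> K" and gj: "g j * f j = c" and pj: "odd (p j)" and rj: "odd (r j)"
    by (simp_all add: Top_def)
  have "r j \<le> p j * r j" using odd_pos[OF pj] by (cases "p j") auto
  then have rj_le: "r j \<le> N" using le_N[OF j] by (rule le_trans)
  have Mj: "copies (r j) (emb b) \<notin> A0" for b using parity[OF rj_le] rj by simp

  have "(\<Sum>k\<in>K. a k \<cdot> x k) \<notin> A0"
    if xj: "x j \<noteq> 0" and cross: "\<And>k. k \<in> K - {j} \<Longrightarrow> x k \<cdot> M j + x j \<cdot> neg (M k) \<in> A0"
  proof
    have cross_0: "copies (r k) (emb b) \<in> A0" if "k \<in> K" "k \<noteq> j" "x k = 0" for k b
    proof -
      have "copies (r k) (emb (\<xi> j * f k)) \<in> A0"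
        using cross[of k] that \<xi>[OF jK xj]
        by (simp add: neg_id M copies_mult_right emb_mult_emb mult_zero_left)
      then show ?thesis by (rule copies_in_A0_transfer)
    qed
    have cross_1: "copies (r j) (emb (\<xi> k * f j)) + copies (r k) (emb (\<xi> j * f k)) \<in> A0"
      if "k \<in> K" "k \<noteq> j" "x k \<noteq> 0" for k
      using cross[of k] that \<xi>[OF jK xj] \<xi>[of k]
      by (simp add: neg_id M copies_mult_right emb_mult_emb)
    have dominated: "r k > 0 \<and> below (\<xi> k * f j) (\<xi> j * f k)"
      if k: "k \<in> K" "k \<noteq> j" "x k \<noteq> 0" for k
    proof -
      have rk: "r k > 0"
        using cross_1[OF k] Mj[of "\<xi> k * f j"] by (cases "r k = 0") auto
      have "below (\<xi> k * f j) (\<xi> j * f k)"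
      proof (rule ccontr)
        assume not: "\<not> below (\<xi> k * f j) (\<xi> j * f k)"
        then have "below (\<xi> j * f k) (\<xi> k * f j)" "\<xi> j * f k \<noteq> \<xi> k * f j"
          using below_total below_refl by metis+
        then have "copies (r j) (emb (\<xi> k * f j)) + copies (r k) (emb (\<xi> j * f k)) =
            copies (r j) (emb (\<xi> k * f j))"
          using copies_add_dominated[of "\<xi> j * f k" "\<xi> k * f j" "r j" "r k"] rj
          by (simp add: odd_pos add.commute)
        then show False using cross_1[OF k] Mj by simp
      qed
      with rk show ?thesis ..
    qed

    let ?X = "{k\<in>K. x k \<noteq> 0}"
    let ?t = "\<lambda>k. f j * (g k * \<xi> k)"
    let ?c = "c * \<xi> j"
    define Q where "Q = {k. k \<in> ?X \<and> ?t k = ?c}"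
    \<comment> \<open>Indices with \<open>p k = 0\<close> must be set aside, since their \<open>g k\<close> is arbitrary.\<close>
    let ?Q = "{k\<in>Q. p k > 0}"
    have jQ: "j \<in> Q" using jK xj by (simp add: Q_def gj[symmetric] ac_simps)
    have t_below: "below (?t k) ?c \<and> (?t k = ?c \<longrightarrow> k \<in> Top \<and> \<xi> k * f j = \<xi> j * f k)"
      if k: "k \<in> ?X" "p k > 0" for k
    proof (cases "k = j")
      case True
      then show ?thesis using j by (simp add: gj[symmetric] ac_simps below_refl)
    next
      case False
      then have d: "r k > 0" "below (\<xi> k * f j) (\<xi> j * f k)" using dominated[of k] k by auto
      have t: "?t k = g k * (\<xi> k * f j)" by (simp add: ac_simps)
      have 1: "below (?t k) (g k * (\<xi> j * f k))" unfolding t by (rule below_mult) (rule d)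
      have "below (g k * f k) c" using i_top[of k] k d by (simp add: c_def)
      then have "below (\<xi> j * (g k * f k)) (\<xi> j * c)" by (rule below_mult)
      then have 2: "below (g k * (\<xi> j * f k)) ?c" by (simp add: ac_simps)
      have "k \<in> Top \<and> \<xi> k * f j = \<xi> j * f k" if eq: "?t k = ?c"
      proof
        have e: "g k * (\<xi> j * f k) = ?c" using 1 2 eq below_antisym by simp
        then have "g k * (\<xi> k * f j) = g k * (\<xi> j * f k)" using eq t by simp
        then show "\<xi> k * f j = \<xi> j * f k" by (rule mult_cancel)
        have "\<xi> j * (g k * f k) = \<xi> j * c" using e by (simp add: ac_simps)
        then have "g k * f k = c" by (rule mult_cancel)
        then show "k \<in> Top" using k by (simp add: Top_def)
      qed
      then show ?thesis using below_trans[OF 1 2] by blast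
    qed
    have rQ: "odd (r k)" if k: "k \<in> ?Q" for k
    proof (cases "k = j")
      case False
      have kX: "k \<in> ?X" "p k > 0" "?t k = ?c" using k by (auto simp: Q_def)
      then have kT: "k \<in> Top" and eq: "\<xi> k * f j = \<xi> j * f k" using t_below by blast+
      have "copies (r j + r k) (emb (\<xi> j * f k)) \<in> A0"
        using cross_1[of k] kX False eq by (simp add: copies_add)
      moreover have "r j + r k \<le> N"
      proof -
        have "r k \<le> p k * r k" using kX by simp
        moreover have "p j * r j + p k * r k = (\<Sum>k\<in>{j, k}. p k * r k)" using False by auto
        moreover have "\<dots> \<le> N"
          unfolding N_def using finTop j kT by (intro sum_mono2) auto
        ultimately show ?thesis using \<open>r j \<le> p j * r j\<close> by linarith
      qed
      ultimately have "even (r j + r k)" using parity by blast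
      then show ?thesis using rj by simp
    qed (use rj in simp)
    have QTop: "?Q \<subseteq> Top" using t_below by (auto simp: Q_def)
    have rest: "even (p k * r k)" if k: "k \<in> Top - ?Q" for k
    proof (cases "p k = 0")
      case False
      have kK: "k \<in> K" using k by (simp add: Top_def)
      have kj: "k \<noteq> j" using k jQ pj by (auto simp: odd_pos)
      have "copies (r k) (emb (\<xi> j * f k)) \<in> A0"
      proof (cases "x k = 0")
        case True
        then show ?thesis using cross_0 kK kj by blast
      next
        case xk: False
        have d: "r k > 0" "below (\<xi> k * f j) (\<xi> j * f k)" using dominated[of k] kK kj xk by auto
        have "\<xi> k * f j \<noteq> \<xi> j * f k"
        proof
          assume eq: "\<xi> k * f j = \<xi> j * f k"
          have "?t k = g k * (\<xi> k * f j)" by (simp add: ac_simps)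
          also have "\<dots> = ?c" using k by (simp add: eq Top_def ac_simps)
          finally show False using k kK xk False by (simp add: Q_def)
        qed
        then show ?thesis
          using copies_add_dominated[OF d(2) _ d(1), of "r j"] cross_1[OF kK kj xk] by simp
      qed
      moreover have "r k \<le> N"
      proof -
        have "r k \<le> p k * r k" using False by (cases "p k") auto
        also have "\<dots> \<le> N" using le_N[of k] k by simp
        finally show ?thesis .
      qed
      ultimately show ?thesis using parity by simp
    qed simp
    have Qsum: "(\<Sum>k\<in>Q. p k) = (\<Sum>k\<in>?Q. p k)"
      using K by (intro sum.mono_neutral_right) (auto simp: Q_def)
    have "odd (\<Sum>k\<in>?Q. p k * r k)"
    proof -
      have "N = (\<Sum>k\<in>Top - ?Q. p k * r k) + (\<Sum>k\<in>?Q. p k * r k)"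
        unfolding N_def by (rule sum.subset_diff[OF QTop finTop])
      moreover have "even (\<Sum>k\<in>Top - ?Q. p k * r k)" using rest by (intro dvd_sum) auto
      ultimately show ?thesis using \<open>odd N\<close> by simp
    qed
    moreover have "even (\<Sum>k\<in>?Q. p k * r k) \<longleftrightarrow> even (\<Sum>k\<in>?Q. p k)"
    proof -
      have fin: "finite ?Q" using K by (simp add: Q_def)
      have "{k \<in> ?Q. odd (p k * r k)} = {k \<in> ?Q. odd (p k)}" using rQ by auto
      then show ?thesis by (simp only: even_sum_iff[OF fin])
    qed
    ultimately have Q_odd: "odd (\<Sum>k\<in>Q. p k)" by (simp add: Qsum)
    have "(\<Sum>k\<in>?Q. p k) \<le> (\<Sum>k\<in>?Q. p k * r k)"
    proof (intro sum_mono)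
      fix k
      assume "k \<in> ?Q"
      then have "r k > 0" using rQ odd_pos by blast
      then show "p k \<le> p k * r k" by (cases "r k") auto
    qed
    also have "\<dots> \<le> N" unfolding N_def using finTop QTop by (intro sum_mono2) auto
    finally have Q_le: "(\<Sum>k\<in>Q. p k) \<le> N" by (simp add: Qsum)

    have "(\<Sum>k\<in>K. a k \<cdot> x k) = (\<Sum>k\<in>?X. a k \<cdot> x k)"
      using K by (intro sum.mono_neutral_right) (auto simp: mult_zero_right)
    then have "emb (f j) \<cdot> (\<Sum>k\<in>K. a k \<cdot> x k) = (\<Sum>k\<in>?X. emb (f j) \<cdot> (a k \<cdot> x k))"
      by (simp only: mult_sum_right)
    also have "\<dots> = (\<Sum>k\<in>?X. copies (p k) (emb (?t k)))"
    proof (intro sum.cong refl)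
      fix k
      assume "k \<in> ?X"
      then have xk: "x k = emb (\<xi> k)" using \<xi> by blast
      show "emb (f j) \<cdot> (a k \<cdot> x k) = copies (p k) (emb (?t k))"
        unfolding xk by (simp add: a copies_mult_left copies_mult_right emb_mult_emb)
    qed
    also have "\<dots> = copies (\<Sum>k\<in>Q. p k) (emb ?c)"
      unfolding Q_def using K t_below Q_odd
      by (intro sum_copies_top) (auto simp: Q_def odd_pos)
    finally have eq: "emb (f j) \<cdot> (\<Sum>k\<in>K. a k \<cdot> x k) = copies (\<Sum>k\<in>Q. p k) (emb ?c)" .
    assume "(\<Sum>k\<in>K. a k \<cdot> x k) \<in> A0"
    then have "copies (\<Sum>k\<in>Q. p k) (emb ?c) \<in> A0" using A0_mult_right eq by metis
    then show False using parity[OF Q_le] Q_odd by simp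
  qed
  moreover have "M j \<notin> A0" using Mj by (simp add: M)
  ultimately show ?thesis using jK by blast
qed

end

section \<open>Dependent columns and singularity\<close>

context uniquely_negated_metatangible_pair
begin

text \<open>
  An exception can only occur at \<open>b = a = (-)a\<close>; cancelling the tangible \<open>a\<close> carries it over to \<open>1\<close>.
\<close>

lemma quasi_absorbing_or_layered:
  "quasi_absorbing_pair lact ract emb A0 neg \<or> layered_pair lact ract emb A0 neg"
proof (cases "\<forall>a b. quasi a + emb b \<in> {emb b, quasi a}")
  case True
  then have "quasi_absorbing_pair lact ract emb A0 neg"
    by (intro quasi_absorbing_pair.intro quasi_absorbing_pair_axioms.intro
        uniquely_negated_metatangible_pair_axioms) blast
  then show ?thesis ..
next
  case False
  then obtain a b where ab: "quasi a + emb b \<notin> {emb b, quasi a}" by auto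
  then have "b = a" "neg (emb a) = emb a" using quasi_add[of b a] by auto
  with ab have a: "neg (emb a) = emb a" "quasi a + emb a \<noteq> emb a" by auto
  have "emb a \<cdot> neg (emb 1) = emb a \<cdot> emb 1"
    by (simp add: neg_mult_right mult_one_right a)
  then have "neg (emb 1) = emb 1" by (rule emb_mult_cancel)
  moreover have "emb 1 + emb 1 + emb 1 \<noteq> emb 1"
  proof
    assume "emb 1 + emb 1 + emb 1 = emb 1"
    then have "emb a \<cdot> (emb 1 + emb 1 + emb 1) = emb a \<cdot> emb 1" by simp
    then have "emb a + emb a + emb a = emb a" by (simp only: mult_add_right mult_one_right)
    then show False using a by simp
  qed
  ultimately have "layered_pair lact ract emb A0 neg" by unfold_locales
  then show ?thesis ..
qed

text \<open>
  The condition on the indices \<open>k\<close> says that \<open>x\<close> is proportional to \<open>M\<close> in the sense of balance, and the conclusion that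
  \<open>x\<close>, like \<open>M\<close>, is then not annihilated by \<open>a\<close>. The index \<open>j\<close> has to be chosen suitably: it depends on \<open>a\<close>
  and \<open>M\<close>.
\<close>

lemma exchange:
  assumes "finite K" "\<And>k. k \<in> K \<Longrightarrow> x k \<in> insert 0 (range emb)"
    and "(\<Sum>k\<in>K. a k \<cdot> M k) \<notin> A0"
  shows "\<exists>j\<in>K. M j \<notin> A0 \<and> (x j \<noteq> 0 \<longrightarrow>
    (\<forall>k\<in>K - {j}. x k \<cdot> M j + x j \<cdot> neg (M k) \<in> A0) \<longrightarrow> (\<Sum>k\<in>K. a k \<cdot> x k) \<notin> A0)"
  using quasi_absorbing_or_layered
proof
  assume "quasi_absorbing_pair lact ract emb A0 neg"
  from quasi_absorbing_pair.exchange_absorbing[OF this assms] show ?thesis .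
next
  assume "layered_pair lact ract emb A0 neg"
  from layered_pair.exchange_layered[OF this assms] show ?thesis .
qed

lemma unit_row_sum: "finite S \<Longrightarrow> k \<in> S \<Longrightarrow> (\<Sum>j\<in>S. unit_row k j \<cdot> x j) = x k"
  by (simp add: sum.remove[of S k] mult_one_left mult_zero_left)

lemma T0_in_A0: "b \<in> insert 0 (range emb) \<Longrightarrow> b \<in> A0 \<Longrightarrow> b = 0"
  using A0_Int_T0 by blast

text \<open>
  Induction on the set \<open>R\<close> outside which all rows are unit rows. If all rows are unit rows, a column at
  which \<open>x\<close> is nonzero must vanish. Otherwise \<open>exchange\<close> is applied to the expansion along a row
  \<open>i\<close> of \<open>R\<close>, and the induction hypothesis supplies its conditions, since it covers every matrix
  whose row \<open>i\<close> is a unit row.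
\<close>

lemma leibniz_singular_of_dependent_columns_unit_rows:
  assumes S: "finite S"
    and "finite R" "R \<subseteq> S" "\<And>r. r \<in> S - R \<Longrightarrow> \<exists>k\<in>S. A r = unit_row k"
    and "\<And>k. k \<in> S \<Longrightarrow> x k \<in> insert 0 (range emb)" "\<exists>k\<in>S. x k \<noteq> 0"
    and "\<And>r. r \<in> S \<Longrightarrow> (\<Sum>k\<in>S. A r k \<cdot> x k) \<in> A0"
  shows "leibniz S A \<in> A0"
  using assms(2-)
proof (induction R arbitrary: A x)
  case empty
  obtain k where k: "k \<in> S" "x k \<noteq> 0" using empty by blast
  have "A r k = 0" if r: "r \<in> S" for r
  proof -
    obtain s where s: "s \<in> S" "A r = unit_row s" using empty.prems(2)[of r] r by auto
    then have "x s \<in> A0" using empty.prems(5)[OF r] by (simp add: unit_row_sum S)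
    then have "x s = 0" using T0_in_A0 empty.prems(3) s by blast
    then have "k \<noteq> s" using k by blast
    then show ?thesis by (simp add: s)
  qed
  then have "leibniz S A = 0" by (rule leibniz_zero_column[OF S k(1)])
  then show ?case by (simp add: A0_zero)
next
  case (insert i R)
  have i: "i \<in> S" and R: "R \<subseteq> S" using insert.prems by auto
  note dep = insert.prems(5)
  let ?M = "\<lambda>k. leibniz S (A(i := unit_row k))"
  have minor: "?M k \<in> A0" if k: "k \<in> S" "x k = 0" for k
  proof (rule insert.IH[of "A(i := unit_row k)" x])
    show "\<exists>s\<in>S. (A(i := unit_row k)) r = unit_row s" if "r \<in> S - R" for r
      using insert.prems(2)[of r] k that by (cases "r = i") auto
    show "(\<Sum>s\<in>S. (A(i := unit_row k)) r s \<cdot> x s) \<in> A0" if "r \<in> S" for r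
      using dep[OF that] by (simp add: unit_row_sum S k A0_zero)
  qed (use R insert.prems in auto)
  show ?case
  proof (rule ccontr)
    assume "leibniz S A \<notin> A0"
    then have "(\<Sum>k\<in>S. A i k \<cdot> ?M k) \<notin> A0"
      using leibniz_expand_row[OF S i, of A] by simp
    then obtain j where j: "j \<in> S" "?M j \<notin> A0" and
      exch: "x j \<noteq> 0 \<longrightarrow> (\<forall>k\<in>S - {j}. x k \<cdot> ?M j + x j \<cdot> neg (?M k) \<in> A0) \<longrightarrow>
        (\<Sum>k\<in>S. A i k \<cdot> x k) \<notin> A0"
      using exchange[where a = "A i" and x = x and M = ?M, OF S insert.prems(3)] by blast
    have xj: "x j \<noteq> 0" using minor j by blast
    have "x k \<cdot> ?M j + x j \<cdot> neg (?M k) \<in> A0" if "k \<in> S - {j}" for k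
    proof (cases "x k = 0")
      case True
      then have "neg (?M k) \<in> A0" using minor that by (simp add: A0_neg)
      then show ?thesis using True by (simp add: mult_zero_left A0_mult_right)
    next
      case False
      have k: "k \<in> S" and jk: "j \<noteq> k" using that by auto
      \<comment> \<open>Column \<open>k\<close> becomes the combination of the columns \<open>j\<close> and \<open>k\<close> with the coefficients in \<open>x\<close>,
          so it gets coefficient 1; column \<open>j\<close> is only needed for the unit row and gets 0.\<close>
      let ?B = "(\<lambda>r. (A r)(k := x k \<cdot> A r k + x j \<cdot> A r j))(i := unit_row j)"
      let ?x = "x(k := emb 1, j := 0)"
      let ?N = "(\<lambda>r. (A r)(k := A r j))(i := unit_row j)"
      have "leibniz S ?B = x k \<cdot> ?M j + x j \<cdot> leibniz S ?N"
        by (rule leibniz_column_linear[OF S k]) (use jk in \<open>auto simp: mult_zero_right\<close>)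
      also have "leibniz S ?N = neg (?M k)"
        by (rule leibniz_move_unit_row[OF S i j(1) k jk])
      finally have det: "leibniz S ?B = x k \<cdot> ?M j + x j \<cdot> neg (?M k)" .
      have "leibniz S ?B \<in> A0"
      proof (rule insert.IH[of ?B ?x])
        show "\<exists>s\<in>S. ?B r = unit_row s" if r: "r \<in> S - R" for r
        proof (cases "r = i")
          case True
          then show ?thesis using j by auto
        next
          case False
          then obtain s where s: "s \<in> S" "A r = unit_row s" using insert.prems(2)[of r] r by auto
          then have "x s \<in> A0" using dep[of r] r by (simp add: unit_row_sum S)
          then have "x s = 0" using T0_in_A0 insert.prems(3) s by blast
          then have "k \<noteq> s" "j \<noteq> s" using xj \<open>x k \<noteq> 0\<close> by auto
          then have "?B r = unit_row s"
            using False s by (auto simp: mult_zero_right)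
          then show ?thesis using s by blast
        qed
        show "\<exists>s\<in>S. ?x s \<noteq> 0"
          using k jk emb_neq_zero by (intro bexI[of _ k]) auto
        show "(\<Sum>s\<in>S. ?B r s \<cdot> ?x s) \<in> A0" if r: "r \<in> S" for r
        proof (cases "r = i")
          case True
          then show ?thesis using unit_row_sum[OF S j(1), of ?x] by (simp add: A0_zero)
        next
          case False
          have j': "j \<in> S - {k}" using j jk by simp
          have rest: "(\<Sum>s\<in>S - {k} - {j}. ?B r s \<cdot> ?x s) = (\<Sum>s\<in>S - {k} - {j}. A r s \<cdot> x s)"
            using False by (intro sum.cong) auto
          have "(\<Sum>s\<in>S. ?B r s \<cdot> ?x s) = (\<Sum>s\<in>S. A r s \<cdot> x s)"
            unfolding sum.remove[OF S k] sum.remove[OF finite_Diff[OF S] j'] rest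
            using False jk by (simp add: mult_one_right mult_zero_left mult_zero_right mult_commute add_ac)
          then show ?thesis using dep[OF r] by simp
        qed
      qed (use R insert.prems in auto)
      then show ?thesis by (simp only: det)
    qed
    then show False using exch xj dep[OF i] by blast
  qed
qed

lemma leibniz_singular_of_dependent_columns:
  assumes "finite S" "\<And>k. k \<in> S \<Longrightarrow> x k \<in> insert 0 (range emb)" "\<exists>k\<in>S. x k \<noteq> 0"
    and "\<And>r. r \<in> S \<Longrightarrow> (\<Sum>k\<in>S. A r k \<cdot> x k) \<in> A0"
  shows "leibniz S A \<in> A0"
  by (rule leibniz_singular_of_dependent_columns_unit_rows[of S S A x]) (use assms in auto)

text \<open>
  The coefficients of the dependence, extended by zero to all of \<open>I\<close>, are the vector \<open>x\<close> over \<open>\<T>\<^sub>0\<close>.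
\<close>

lemma dependent_family_singular:
  fixes n :: nat
  assumes dep: "dependent_family lact A0 m v I" and I: "finite I"
    and f: "bij_betw f {0..<n} I" and g: "\<And>q. q < n \<Longrightarrow> g q < m"
  shows "leibniz {0..<n} (\<lambda>q p. v (f p) $ g q) \<in> A0"
proof -
  obtain I' a where I': "I' \<subseteq> I" "I' \<noteq> {}"
    and a: "\<And>j. j < m \<Longrightarrow> (\<Sum>i\<in>I'. a i \<rhd> v i $ j) \<in> A0"
    using dep unfolding dependent_family_def by blast
  let ?x = "\<lambda>i. if i \<in> I' then emb (a i) else 0"
  show ?thesis
  proof (rule leibniz_singular_of_dependent_columns[where x = "\<lambda>p. ?x (f p)"])
    obtain i where "i \<in> I'" using I' by blast
    then obtain p where "p \<in> {0..<n}" "f p = i" using I' bij_betw_imp_surj_on[OF f] by blast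
    then show "\<exists>p\<in>{0..<n}. ?x (f p) \<noteq> 0"
      using \<open>i \<in> I'\<close> emb_neq_zero by (intro bexI[of _ p]) auto
    fix q
    assume "q \<in> {0..<n}"
    then have q: "g q < m" using g by simp
    have "(\<Sum>p\<in>{0..<n}. v (f p) $ g q \<cdot> ?x (f p)) = (\<Sum>i\<in>I. v i $ g q \<cdot> ?x i)"
      by (rule sum.reindex_bij_betw[OF f])
    also have "\<dots> = (\<Sum>i\<in>I'. v i $ g q \<cdot> ?x i)"
      using I I' by (intro sum.mono_neutral_right) (auto simp: mult_zero_right)
    also have "\<dots> = (\<Sum>i\<in>I'. a i \<rhd> v i $ g q)"
      by (intro sum.cong) (auto simp: mult_commute[of _ "emb _"] pair_mult_emb_left)
    finally show "(\<Sum>p\<in>{0..<n}. v (f p) $ g q \<cdot> ?x (f p)) \<in> A0" using a[OF q] by simp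
  qed auto
qed

section \<open>Ranks\<close>

lemma bij_betw_pick:
  assumes "finite I"
  shows "bij_betw (pick I) {0..<card I} I"
proof -
  have "inj_on (pick I) {0..<card I}"
    by (intro linorder_inj_onI) (auto dest: pick_mono_le)
  moreover have "pick I ` {0..<card I} \<subseteq> I" using pick_in_set_le by auto
  ultimately show ?thesis
    using assms by (simp add: bij_betw_def card_image card_subset_eq)
qed

lemma independent_of_nonsingular_submatrix:
  assumes I: "I \<subseteq> {0..<dim_row M}" and J: "J \<subseteq> {0..<dim_col M}" and IJ: "card I = card J"
    and nonsing: "nonsingular emb A0 neg (submatrix M I J)"
  shows "\<not> dependent_family lact A0 (dim_col M) (row M) I"
    and "\<not> dependent_family lact A0 (dim_row M) (col M) J"
proof -
  let ?n = "card I"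
  let ?B = "\<lambda>p q. M $$ (pick I p, pick J q)"
  have rows: "{i. i < dim_row M \<and> i \<in> I} = I" and cols: "{j. j < dim_col M \<and> j \<in> J} = J"
    using I J by auto
  have finI: "finite I" and finJ: "finite J" using I J finite_subset by blast+
  have pickI: "pick I p < dim_row M" if "p < ?n" for p using pick_in_set_le[OF that] I by auto
  have pickJ: "pick J q < dim_col M" if "q < ?n" for q
    using pick_in_set_le[of q J] that J IJ by auto
  have "pair_det emb neg (submatrix M I J) = leibniz {0..<?n} ?B"
    unfolding pair_det_eq_leibniz dim_submatrix rows
    by (intro leibniz_cong) (simp add: submatrix_index rows cols IJ[symmetric])
  then have B: "leibniz {0..<?n} ?B \<notin> A0" using nonsing by (simp add: nonsingular_def)
  show "\<not> dependent_family lact A0 (dim_col M) (row M) I"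
  proof
    assume "dependent_family lact A0 (dim_col M) (row M) I"
    then have "leibniz {0..<?n} (\<lambda>q p. row M (pick I p) $ pick J q) \<in> A0"
      by (rule dependent_family_singular[OF _ finI bij_betw_pick[OF finI]]) (rule pickJ)
    also have "leibniz {0..<?n} (\<lambda>q p. row M (pick I p) $ pick J q) = leibniz {0..<?n} (\<lambda>q p. ?B p q)"
      using pickI pickJ by (intro leibniz_cong) simp
    also have "\<dots> = leibniz {0..<?n} ?B" by (rule leibniz_transpose) simp
    finally show False using B by simp
  qed
  show "\<not> dependent_family lact A0 (dim_row M) (col M) J"
  proof
    assume "dependent_family lact A0 (dim_row M) (col M) J"
    then have "leibniz {0..<?n} (\<lambda>q p. col M (pick J p) $ pick I q) \<in> A0"
      by (rule dependent_family_singular[OF _ finJ bij_betw_pick[OF finJ, folded IJ]]) (rule pickI)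
    also have "leibniz {0..<?n} (\<lambda>q p. col M (pick J p) $ pick I q) = leibniz {0..<?n} ?B"
      using pickI pickJ by (intro leibniz_cong) simp
    finally show False using B by simp
  qed
qed

lemma nonsingular_empty: "nonsingular emb A0 neg (submatrix M {} {})"
  by (simp add: nonsingular_def pair_det_def dim_submatrix emb_notin_A0)

end

theorem theorem9:
  fixes lact :: "'t::comm_monoid_mult \<Rightarrow> 'a::comm_monoid_add \<Rightarrow> 'a"
    and ract :: "'a \<Rightarrow> 't \<Rightarrow> 'a"
    and emb :: "'t \<Rightarrow> 'a"
    and A0 :: "'a set"
    and neg :: "'a \<Rightarrow> 'a"
  assumes "uniquely_negated_metatangible_pair lact ract emb A0 neg"
  shows "\<forall>M. submatrix_rank emb A0 neg M \<le> row_rank lact A0 M \<and>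
             submatrix_rank emb A0 neg M \<le> col_rank lact A0 M"
proof
  fix M
  interpret uniquely_negated_metatangible_pair lact ract emb A0 neg by fact
  have card_finite: "finite {card I | I. I \<subseteq> {0..<n} \<and> P I}" for n :: nat and P
    by (rule finite_subset[of _ "card ` Pow {0..<n}"]) auto
  let ?C = "{card I | I J. I \<subseteq> {0..<dim_row M} \<and> J \<subseteq> {0..<dim_col M} \<and> card I = card J \<and>
    nonsingular emb A0 neg (submatrix M I J)}"
  have "?C \<noteq> {}" using nonsingular_empty[of M] by blast
  moreover have "finite ?C"
    by (rule finite_subset[of _ "card ` Pow {0..<dim_row M}"]) auto
  ultimately have "Max ?C \<in> ?C" by (rule Max_in[rotated])
  then obtain I J where rank: "submatrix_rank emb A0 neg M = card I"
    and I: "I \<subseteq> {0..<dim_row M}" and J: "J \<subseteq> {0..<dim_col M}" and IJ: "card I = card J"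
    and "nonsingular emb A0 neg (submatrix M I J)"
    unfolding submatrix_rank_def by blast
  note independent = independent_of_nonsingular_submatrix[OF I J IJ this(5)]
  have "card I \<le> row_rank lact A0 M"
    unfolding row_rank_def by (rule Max_ge[OF card_finite]) (use I independent(1) in blast)
  moreover have "card J \<le> col_rank lact A0 M"
    unfolding col_rank_def by (rule Max_ge[OF card_finite]) (use J independent(2) in blast)
  ultimately show "submatrix_rank emb A0 neg M \<le> row_rank lact A0 M \<and>
      submatrix_rank emb A0 neg M \<le> col_rank lact A0 M"
    by (simp add: rank IJ)
qed

end
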